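(* Let $\Omega$ and $\Omega'$ be two aperiodic, repetitive tiling spaces of $\mathbb{R}^d$ with finite local complexity which are homeomorphic. Then the dynamical system $(\Omega,\mathbb{R}^d)$ has positive topological entropy if and only if $(\Omega',\mathbb{R}^d)$ does.
   Context: Tilings. A tile is a compact subset of $\mathbb{R}^d$ homeomorphic to a closed ball and equal to the closure of its interior (possibly decorated with a label); a prototile is an equivalence class of tiles under translation. For each tiling space a finite collection of prototiles is fixed. A tiling is a collection $T=\{t_i\}_{i\in I}$ of tiles whose translation classes are in this collection, whose union is $\mathbb{R}^d$, and such that $t_i\cap t_j$ has empty interior for $i\neq j$. For $x\in\mathbb{R}^d$, $T-x=\{t_i-x\}_{i\in I}$ (tilings are not identified with their translates). $B(x,r)$ is the ball of centre $x$ and radius $r$, and $T\cap B(x,r)$ denotes the patch of all tiles of $T$ which intersect $B(x,r)$. $T$ is aperiodic if $T-x\neq T$ for all $x\neq 0$; $T$ has finite local complexity (FLC) if for all $R>0$ there are finitely many patches $T\cap B(x,R)$, $x\in\mathbb{R}^d$, up to translation; $T$ is repetitive if for every finite patch $P\subset T$ there is $R>0$ such that a translate of $P$ appears in $T\cap B(x,R)$ for every $x\in\mathbb{R}^d$. Tiling spaces. Define a distance on tilings with the given prototiles by letting $D(T_1,T_2)$ be the minimum of $1/\sqrt2$ and the infimum of all $\varepsilon>0$ for which there are $x_1,x_2\in\mathbb{R}^d$ with $\|x_i\|\le\varepsilon$ such that $T_1-x_1$ and $T_2-x_2$ agree on $B(0,1/\varepsilon)$. The hull (tiling space) of $T$ is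 the closure $\Omega=\overline{\{T-x : x\in\mathbb{R}^d\}}$ for $D$; it is compact and $\mathbb{R}^d$ acts continuously on it by translation. An aperiodic repetitive tiling space with FLC is the hull of an aperiodic, repetitive tiling with FLC. Entropy. Topological entropy is that of the continuous $\mathbb{R}^d$-action by translation. For FLC tiling spaces it is known (Baake–Lenz–Richard) to equal the patch-counting entropy $H_{\mathrm{pc}}(\Omega)=\limsup_{r\to+\infty}\frac{\log p(r)}{r^d}$, where $p$ is a complexity function of $\Omega$: $p(r)=\mathrm{Card}\{T\cap B(0,r): T\in\Xi\}$ for a canonical transversal $\Xi$. Here a canonical transversal is a set $\Xi=\{T\in\Omega: 0\in\mathcal{D}(T)\}$, where $\mathcal{D}$ is a local pointing rule, i.e. a map assigning to each $T\in\Omega$ a Delaunay (uniformly discrete and relatively dense) set $\mathcal{D}(T)\subset\mathbb{R}^d$, commuting with translations, such that for some $\rho,R>0$ and all $T\in\Omega$, $\mathcal{D}(T)\cap B(0,\rho)$ only depends on $T\cap B(0,R)$. *)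

theory Defs
  imports "HOL-Analysis.Analysis"
begin

section \<open>Tiles and tilings\<close>

text \<open>A tile is a support together with a label; undecorated tiles are the case of label type
  \<^typ>\<open>unit\<close>.\<close>

type_synonym ('a, 'l) tile = "'a set \<times> 'l"
type_synonym ('a, 'l) tiling = "('a, 'l) tile set"

definition is_tile :: "('a::euclidean_space, 'l) tile \<Rightarrow> bool" where
  "is_tile t \<longleftrightarrow>
     compact (fst t) \<and> fst t homeomorphic cball (0::'a) 1 \<and> closure (interior (fst t)) = fst t"

text \<open>\<open>tile_shift x t\<close> is \<open>t - x\<close>, and \<open>shift x T\<close> is \<open>T - x\<close>.\<close>

definition tile_shift :: "'a::euclidean_space \<Rightarrow> ('a, 'l) tile \<Rightarrow> ('a, 'l) tile" where
  "tile_shift x t = ((\<lambda>y. y - x) ` fst t, snd t)"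

definition shift :: "'a::euclidean_space \<Rightarrow> ('a, 'l) tiling \<Rightarrow> ('a, 'l) tiling" where
  "shift x T = tile_shift x ` T"

definition tile_class :: "('a::euclidean_space, 'l) tile \<Rightarrow> ('a, 'l) tile set" where
  "tile_class t = range (\<lambda>x. tile_shift x t)"

definition prototile_set :: "('a::euclidean_space, 'l) tile set set \<Rightarrow> bool" where
  "prototile_set \<P> \<longleftrightarrow> finite \<P> \<and> (\<forall>p\<in>\<P>. \<exists>t. is_tile t \<and> p = tile_class t)"

definition is_tiling :: "('a::euclidean_space, 'l) tile set set \<Rightarrow> ('a, 'l) tiling \<Rightarrow> bool" where
  "is_tiling \<P> T \<longleftrightarrow>
     (\<forall>t\<in>T. is_tile t \<and> tile_class t \<in> \<P>) \<and>
     (\<Union>t\<in>T. fst t) = UNIV \<and>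
     (\<forall>s\<in>T. \<forall>t\<in>T. s \<noteq> t \<longrightarrow> interior (fst s \<inter> fst t) = {})"

text \<open>\<open>patch T x r\<close> is \<open>T \<inter> B(x,r)\<close>.\<close>

definition patch :: "('a::euclidean_space, 'l) tiling \<Rightarrow> 'a \<Rightarrow> real \<Rightarrow> ('a, 'l) tile set" where
  "patch T x r = {t \<in> T. fst t \<inter> ball x r \<noteq> {}}"

definition aperiodic :: "('a::euclidean_space, 'l) tiling \<Rightarrow> bool" where
  "aperiodic T \<longleftrightarrow> (\<forall>x. x \<noteq> 0 \<longrightarrow> shift x T \<noteq> T)"

definition FLC :: "('a::euclidean_space, 'l) tiling \<Rightarrow> bool" where
  "FLC T \<longleftrightarrow> (\<forall>R>0. finite {range (\<lambda>y. shift y (patch T x R)) | x. True})"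

definition repetitive :: "('a::euclidean_space, 'l) tiling \<Rightarrow> bool" where
  "repetitive T \<longleftrightarrow>
     (\<forall>Q. finite Q \<and> Q \<subseteq> T \<longrightarrow> (\<exists>R>0. \<forall>x. \<exists>y. shift y Q \<subseteq> patch T x R))"


section \<open>Tiling spaces\<close>

text \<open>The set of admissible \<open>\<epsilon>\<close> may be empty (for instance when the two tilings use different
  prototiles), in which case its infimum is \<open>\<infinity>\<close>; putting \<open>1 / sqrt 2\<close> into the set expresses
  the minimum without evaluating \<^const>\<open>Inf\<close> on the empty set of reals.\<close>

definition tiling_dist :: "('a::euclidean_space, 'l) tiling \<Rightarrow> ('a, 'l) tiling \<Rightarrow> real" where
  "tiling_dist T1 T2 =
     Inf (insert (1 / sqrt 2)
       {\<epsilon>. \<epsilon> > 0 \<and> (\<exists>x1 x2. norm x1 \<le> \<epsilon> \<and> norm x2 \<le> \<epsilon> \<and>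
              patch (shift x1 T1) 0 (1 / \<epsilon>) = patch (shift x2 T2) 0 (1 / \<epsilon>))})"

definition tiling_topology ::
    "('a::euclidean_space, 'l) tile set set \<Rightarrow> ('a, 'l) tiling topology" where
  "tiling_topology \<P> = Metric_space.mtopology {T. is_tiling \<P> T} tiling_dist"

definition tiling_hull ::
    "('a::euclidean_space, 'l) tile set set \<Rightarrow> ('a, 'l) tiling \<Rightarrow> ('a, 'l) tiling set" where
  "tiling_hull \<P> T = tiling_topology \<P> closure_of (range (\<lambda>x. shift x T))"

definition aperiodic_repetitive_FLC_space ::
    "('a::euclidean_space, 'l) tile set set \<Rightarrow> ('a, 'l) tiling set \<Rightarrow> bool" where
  "aperiodic_repetitive_FLC_space \<P> \<Omega> \<longleftrightarrow>
     prototile_set \<P> \<and>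
     (\<exists>T. is_tiling \<P> T \<and> aperiodic T \<and> repetitive T \<and> FLC T \<and> \<Omega> = tiling_hull \<P> T)"


section \<open>Topological entropy\<close>

text \<open>Bowen's definition for an action \<open>\<alpha>\<close> of a Euclidean space on a compact metric space
  \<open>(X, d)\<close>. Two points are \<open>(r, \<epsilon>)\<close>-separated if they are at distance more than \<open>\<epsilon>\<close> for the metric
  \<open>sup {d (\<alpha> t x) (\<alpha> t y) | t \<in> B(0,r)}\<close>.\<close>

definition separated_set ::
    "('x \<Rightarrow> 'x \<Rightarrow> real) \<Rightarrow> ('v::euclidean_space \<Rightarrow> 'x \<Rightarrow> 'x) \<Rightarrow> real \<Rightarrow> real \<Rightarrow> 'x set \<Rightarrow> bool" where
  "separated_set d \<alpha> r \<epsilon> S \<longleftrightarrow>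
     (\<forall>x\<in>S. \<forall>y\<in>S. x \<noteq> y \<longrightarrow> (\<exists>t\<in>ball 0 r. d (\<alpha> t x) (\<alpha> t y) > \<epsilon>))"

text \<open>The logarithm of the maximal cardinality of an \<open>(r, \<epsilon>)\<close>-separated subset of \<open>X\<close>. It is taken
  in the extended reals so that the supremum is meaningful without presupposing that it is
  finite.\<close>

definition log_separation_number ::
    "'x set \<Rightarrow> ('x \<Rightarrow> 'x \<Rightarrow> real) \<Rightarrow> ('v::euclidean_space \<Rightarrow> 'x \<Rightarrow> 'x) \<Rightarrow> real \<Rightarrow> real \<Rightarrow> ereal" where
  "log_separation_number X d \<alpha> r \<epsilon> =
     (SUP S\<in>{S. finite S \<and> S \<noteq> {} \<and> S \<subseteq> X \<and> separated_set d \<alpha> r \<epsilon> S}. ereal (ln (real (card S))))"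

text \<open>The growth rate is monotone in \<open>\<epsilon>\<close>, so the limit as \<open>\<epsilon> \<rightarrow> 0\<close> is the supremum over
  \<open>\<epsilon> > 0\<close>. The normalisation is by \<open>r ^ d\<close>, as in the patch-counting entropy
  \<open>limsup log p(r) / r ^ d\<close>; normalising by the volume of the ball of radius \<open>r\<close> only
  changes the value by a positive constant factor.\<close>

definition topological_entropy ::
    "'x set \<Rightarrow> ('x \<Rightarrow> 'x \<Rightarrow> real) \<Rightarrow> ('v::euclidean_space \<Rightarrow> 'x \<Rightarrow> 'x) \<Rightarrow> ereal" where
  "topological_entropy X d \<alpha> =
     (SUP \<epsilon>\<in>{0<..}. Limsup at_top
        (\<lambda>r::real. log_separation_number X d \<alpha> r \<epsilon> / ereal (r ^ DIM('v))))"

end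

theory Submission
  imports Defs "HOL-Library.Diagonal_Subsequence"
begin

text \<open>
  Let \<open>f : \<Omega> \<rightarrow> \<Omega>'\<close> be a homeomorphism with inverse \<open>g\<close>. The idea is that \<open>f\<close>
  distorts distances along orbits at most linearly, and that it carries tilings which stay close
  along a large ball of translations to tilings which stay close along a ball whose radius is
  smaller only by a constant factor. Hence \<open>g\<close> turns an \<open>(r, \<epsilon>)\<close>-separated subset of
  \<open>\<Omega>'\<close> into a \<open>(K r, \<delta>)\<close>-separated subset of \<open>\<Omega>\<close>, so the numbers of separated points satisfy
  \<open>N'(r, \<epsilon>) \<le> N(K r, \<delta>)\<close>. Replacing \<open>r\<close> by \<open>K r\<close> costs a factor \<open>K ^ d\<close> in the growth rate,
  which does not affect its positivity; exchanging \<open>f\<close> and \<open>g\<close> gives the converse.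

  Both claims about \<open>f\<close> rest on rigidity: a tile and its translate by a small nonzero vector cannot lie in
  the same tiling, so two tilings that almost agree near a point differ there by a unique small
  displacement (\<open>displacement_unique\<close>). When the base point moves continuously this displacement can
  only stay constant. A short path of tilings therefore remains in the orbit of its starting point
  (\<open>short_path_in_orbit\<close>); this is the statement that the transversals of the space are totally
  disconnected. Gluing short pieces, every path lifts to a path of translation vectors with control
  on its modulus of continuity (\<open>orbit_lift\<close>).

  Suppose now that \<open>g S\<close> and \<open>g T\<close> stay close along a ball of radius \<open>K r\<close>. Constancy of the
  displacement shows that, up to one small translation, they coincide near every point of that ball.
  For \<open>|t| < r\<close> the path \<open>g (T - \<tau> t)\<close> lifts to a path in the ball of radius \<open>K r\<close>.
  Translating \<open>g S\<close> along the same lift and applying \<open>f\<close> gives a path in the orbit of a tiling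
  close to \<open>S\<close>, which remains near \<open>T - \<tau> t\<close>. Once more the displacement between them is constant,
  and it is small for \<open>\<tau> = 0\<close>; so \<open>S - t\<close> and \<open>T - t\<close> are close (\<open>separation_transfer\<close>).

  The constants are uniform because \<open>f\<close> and \<open>g\<close> are uniformly continuous, which follows from
  compactness of the hull. By finite local complexity only finitely many patches of a given size
  contain a given tile, and a diagonal argument produces convergent subsequences
  (\<open>hull_seq_compact\<close>).
\<close>

section \<open>Translating tilings and comparing their patches\<close>

lemma tile_shift_0 [simp]: "tile_shift 0 t = t"
  by (simp add: tile_shift_def)

lemma tile_shift_tile_shift [simp]: "tile_shift x (tile_shift y t) = tile_shift (x + y) t"
  by (simp add: tile_shift_def image_image algebra_simps)

lemma shift_0 [simp]: "shift 0 T = T"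
  by (simp add: shift_def)

lemma shift_shift [simp]: "shift x (shift y T) = shift (x + y) T"
  by (simp add: shift_def image_image)

lemma fst_tile_shift: "y \<in> fst (tile_shift x t) \<longleftrightarrow> y + x \<in> fst t"
  by (force simp: tile_shift_def)

lemma mem_shift_iff: "t \<in> shift x T \<longleftrightarrow> tile_shift (- x) t \<in> T"
  unfolding shift_def by (force simp: image_iff)

definition agree :: "('a::euclidean_space, 'l) tiling \<Rightarrow> ('a, 'l) tiling \<Rightarrow> 'a \<Rightarrow> real \<Rightarrow> bool" where
  "agree S T c R \<longleftrightarrow> patch S c R = patch T c R"

lemma agree_iff:
  "agree S T c R \<longleftrightarrow> (\<forall>t y. y \<in> fst t \<longrightarrow> dist c y < R \<longrightarrow> (t \<in> S \<longleftrightarrow> t \<in> T))"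
  unfolding agree_def patch_def by (auto simp: set_eq_iff disjoint_iff simp del: split_paired_All)

lemma agreeD: "agree S T c R \<Longrightarrow> y \<in> fst t \<Longrightarrow> dist c y < R \<Longrightarrow> t \<in> S \<longleftrightarrow> t \<in> T"
  unfolding agree_iff by blast

lemma agree_refl [simp]: "agree T T c R"
  by (simp add: agree_def)

lemma agree_sym: "agree S T c R \<Longrightarrow> agree T S c R"
  by (simp add: agree_def)

lemma agree_trans: "agree S T c R \<Longrightarrow> agree T U c R \<Longrightarrow> agree S U c R"
  by (simp add: agree_def)

lemma agree_mono:
  fixes S T :: "('a::euclidean_space, 'l) tiling"
  assumes "agree S T c R" "dist c c' + R' \<le> R"
  shows "agree S T c' R'"
  unfolding agree_iff
proof (intro allI impI)
  fix t :: "('a, 'l) tile" and y assume "y \<in> fst t" "dist c' y < R'"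
  then show "t \<in> S \<longleftrightarrow> t \<in> T"
    using assms dist_triangle[of c y c'] by (intro agreeD[OF assms(1), of y]) auto
qed

lemma patch_shift: "patch (shift x T) c r = shift x (patch T (c + x) r)"
proof -
  have "fst t \<inter> ball c r \<noteq> {} \<longleftrightarrow> fst (tile_shift (- x) t) \<inter> ball (c + x) r \<noteq> {}" for t :: "('a, 'b) tile"
  proof
    assume "fst t \<inter> ball c r \<noteq> {}"
    then obtain y where "y \<in> fst t" "dist c y < r" by auto
    then have "y + x \<in> fst (tile_shift (- x) t) \<inter> ball (c + x) r" by (simp add: fst_tile_shift)
    then show "fst (tile_shift (- x) t) \<inter> ball (c + x) r \<noteq> {}" by blast
  next
    assume "fst (tile_shift (- x) t) \<inter> ball (c + x) r \<noteq> {}"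
    then obtain z where "z \<in> fst (tile_shift (- x) t)" "dist (c + x) z < r" by auto
    then have "z - x \<in> fst t \<inter> ball c r" by (simp add: fst_tile_shift dist_norm algebra_simps)
    then show "fst t \<inter> ball c r \<noteq> {}" by blast
  qed
  then show ?thesis
    unfolding patch_def by (intro set_eqI) (simp add: mem_shift_iff)
qed

lemma agree_shift: "agree (shift x S) (shift x T) c R \<longleftrightarrow> agree S T (c + x) R"
proof -
  have "shift x A = shift x B \<longleftrightarrow> A = B" for A B :: "('a, 'b) tiling"
  proof
    assume "shift x A = shift x B"
    from arg_cong[OF this, of "shift (- x)"] show "A = B" by simp
  qed simp
  then show ?thesis unfolding agree_def patch_shift .
qed

text \<open>A lower bound for the distance between translates of one tile inside a tiling. Covering and
  nonemptiness of the tiles are included because they supply the common tile to which the bound is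
  applied.\<close>

definition rigid :: "real \<Rightarrow> ('a::euclidean_space, 'l) tiling \<Rightarrow> bool" where
  "rigid \<kappa> T \<longleftrightarrow> (\<Union>t\<in>T. fst t) = UNIV \<and> (\<forall>t\<in>T. fst t \<noteq> {}) \<and>
     (\<forall>t\<in>T. \<forall>u. norm u < \<kappa> \<longrightarrow> tile_shift u t \<in> T \<longrightarrow> u = 0)"

lemma rigid_shift: "rigid \<kappa> T \<Longrightarrow> rigid \<kappa> (shift x T)"
  unfolding rigid_def
proof (intro conjI; elim conjE)
  assume "(\<Union>t\<in>T. fst t) = UNIV"
  then have "\<exists>t\<in>T. y + x \<in> fst t" for y
    by blast
  then show "(\<Union>t\<in>shift x T. fst t) = UNIV"
    by (auto simp: shift_def fst_tile_shift)
next
  assume "\<forall>t\<in>T. fst t \<noteq> {}"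
  then show "\<forall>t\<in>shift x T. fst t \<noteq> {}"
    by (simp add: shift_def tile_shift_def)
next
  assume R: "\<forall>t\<in>T. \<forall>u. norm u < \<kappa> \<longrightarrow> tile_shift u t \<in> T \<longrightarrow> u = 0"
  show "\<forall>t\<in>shift x T. \<forall>u. norm u < \<kappa> \<longrightarrow> tile_shift u t \<in> shift x T \<longrightarrow> u = 0"
  proof (intro ballI allI impI)
    fix t u assume "t \<in> shift x T" "norm u < \<kappa>" "tile_shift u t \<in> shift x T"
    then show "u = 0"
      using R[rule_format, of "tile_shift (- x) t" u] by (simp add: mem_shift_iff add.commute)
  qed
qed

lemma rigid_covers:
  assumes "rigid \<kappa> T" obtains t where "t \<in> T" "y \<in> fst t"
proof -
  have "y \<in> (\<Union>t\<in>T. fst t)"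
    using assms by (simp add: rigid_def)
  then show thesis
    using that by blast
qed

lemma agree_everywhere:
  assumes "rigid \<kappa> S" "rigid \<kappa> T" "\<And>R. 0 < R \<Longrightarrow> agree S T 0 R"
  shows "S = T"
proof -
  have "t \<in> S \<longleftrightarrow> t \<in> T" if t: "t \<in> S \<union> T" for t
  proof -
    obtain y where "y \<in> fst t" using assms(1,2) t unfolding rigid_def by blast
    then show ?thesis
      using agreeD[OF assms(3)[of "norm y + 1"], of y t] by (simp add: add_nonneg_pos)
  qed
  then show ?thesis by blast
qed

text \<open>A tile of \<open>T\<close> through the common point \<open>y\<close> comes from two tiles of \<open>S\<close> that are
  translates of each other by \<open>a - b\<close>, and rigidity excludes this unless \<open>a = b\<close>. All the
  local constancy arguments below are applications of this fact.\<close>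

lemma displacement_unique:
  assumes "rigid \<kappa> S" "rigid \<kappa> T"
    and a: "agree (shift a S) T c R" "dist c y < R"
    and b: "agree (shift b S) T c' R'" "dist c' y < R'"
    and ab: "norm (a - b) < \<kappa>"
  shows "a = b"
proof -
  obtain t where t: "t \<in> T" "y \<in> fst t"
    using rigid_covers assms(2) by blast
  have "tile_shift (- a) t \<in> S" "tile_shift (- b) t \<in> S"
    using agreeD[OF a(1) t(2) a(2)] agreeD[OF b(1) t(2) b(2)] t(1) by (auto simp: mem_shift_iff)
  moreover have "tile_shift (a - b) (tile_shift (- a) t) = tile_shift (- b) t"
    by simp
  ultimately have "a - b = 0"
    using assms(1) ab unfolding rigid_def by metis
  then show ?thesis by simp
qed

text \<open>Translating only one of the two tilings makes the displacement a single vector. The relation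
  is comparable to \<^term>\<open>tiling_dist S T \<le> e\<close> up to a factor of two in a small \<open>e\<close>, see \<open>near_tiling_dist\<close> and
  \<open>tiling_dist_near\<close>.\<close>

definition near :: "real \<Rightarrow> ('a::euclidean_space, 'l) tiling \<Rightarrow> ('a, 'l) tiling \<Rightarrow> bool" where
  "near e S T \<longleftrightarrow> (\<exists>w. norm w \<le> e \<and> agree (shift w S) T 0 (1 / e))"

lemma near_mono:
  assumes "near d S T" "0 < d" "d \<le> e"
  shows "near e S T"
proof -
  obtain w where "norm w \<le> d" "agree (shift w S) T 0 (1 / d)"
    using assms(1) by (auto simp: near_def)
  moreover have "1 / e \<le> 1 / d"
    using assms by (simp add: frac_le)
  ultimately show ?thesis
    unfolding near_def using assms(3) agree_mono[of _ _ 0 "1/d" 0 "1/e"] by (intro exI[of _ w]) auto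
qed

lemma near_shift: "norm w \<le> e \<Longrightarrow> near e T (shift w T)"
  unfolding near_def by auto

lemma near_orbit: "norm (x - y) \<le> e \<Longrightarrow> near e (shift x T) (shift y T)"
  using near_shift[of "y - x" e "shift x T"] by (simp add: norm_minus_commute)

lemma nearI_agree:
  assumes "agree S T c (1 / e)" "0 < e" shows "near e (shift c S) (shift c T)"
  unfolding near_def using assms by (intro exI[of _ 0]) (auto simp: agree_shift)

section \<open>The distance between tilings\<close>

lemma near_tiling_dist:
  assumes "near e S T" "0 < e" shows "tiling_dist S T \<le> e"
proof -
  obtain w where "norm w \<le> e" "patch (shift w S) 0 (1 / e) = patch (shift 0 T) 0 (1 / e)"
    using assms(1) by (auto simp: near_def agree_def)
  then have "\<exists>x1 x2. norm x1 \<le> e \<and> norm x2 \<le> e \<and>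
              patch (shift x1 S) 0 (1 / e) = patch (shift x2 T) 0 (1 / e)"
    using \<open>0 < e\<close> by (metis less_imp_le norm_zero)
  then show ?thesis
    unfolding tiling_dist_def using \<open>0 < e\<close>
    by (intro cInf_lower bdd_belowI[of _ 0]) auto
qed

lemma tiling_dist_less:
  assumes "tiling_dist S T < e" "e \<le> 1 / sqrt 2"
  obtains d x y where "0 < d" "d < e" "norm x \<le> d" "norm y \<le> d"
    "agree (shift x S) (shift y T) 0 (1 / d)"
proof -
  let ?A = "insert (1 / sqrt 2) {d. d > 0 \<and> (\<exists>x y. norm x \<le> d \<and> norm y \<le> d \<and>
              patch (shift x S) 0 (1 / d) = patch (shift y T) 0 (1 / d))}"
  have "\<exists>d\<in>?A. d < e"
    using assms(1) unfolding tiling_dist_def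
    by (subst (asm) cInf_less_iff) (auto intro!: bdd_belowI[of _ 0])
  then show ?thesis
    using that assms(2) by (auto simp: agree_def)
qed

text \<open>Moving both translations to \<open>S\<close> shifts the ball of agreement by at most \<open>e\<close>; halving its radius
  \<open>1 / e\<close> absorbs this because \<open>2 * e\<^sup>2 \<le> 1\<close>.\<close>

lemma tiling_dist_near:
  assumes "tiling_dist S T < e" "e \<le> 1 / 2"
  shows "near (2 * e) S T"
proof -
  have "e \<le> 1 / sqrt 2"
  proof -
    have "sqrt 2 \<le> 2" by (simp add: real_le_lsqrt)
    then have "1 / 2 \<le> 1 / sqrt 2" by (simp add: frac_le)
    then show ?thesis using assms(2) by linarith
  qed
  then obtain d x y where d: "0 < d" "d < e" "norm x \<le> d" "norm y \<le> d"
    "agree (shift x S) (shift y T) 0 (1 / d)"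
    using tiling_dist_less assms(1) by blast
  have "agree (shift (- y) (shift x S)) (shift (- y) (shift y T)) y (1 / d)"
    unfolding agree_shift using d(5) by simp
  then have 1: "agree (shift (x - y) S) T y (1 / d)" by simp
  have "1 / (2 * e) \<le> 1 / (2 * d)"
    using d by (simp add: frac_le)
  moreover have "1 / (2 * d) + d \<le> 1 / d"
  proof -
    have "d * d \<le> 1/2 * 1" using d assms(2) by (intro mult_mono) auto
    then show ?thesis using d(1) by (simp add: field_simps)
  qed
  ultimately have "agree (shift (x - y) S) T 0 (1 / (2 * e))"
    using d(4) by (intro agree_mono[OF 1]) simp
  moreover have "norm (x - y) \<le> 2 * e"
    using norm_triangle_ineq4[of x y] d by simp
  ultimately show ?thesis unfolding near_def by blast
qed

lemma tiling_dist_commute: "tiling_dist S T = tiling_dist T S"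
proof -
  have "{e. e > 0 \<and> (\<exists>x y. norm x \<le> e \<and> norm y \<le> e \<and>
            patch (shift x S) 0 (1 / e) = patch (shift y T) 0 (1 / e))}
      = {e. e > 0 \<and> (\<exists>x y. norm x \<le> e \<and> norm y \<le> e \<and>
            patch (shift x T) 0 (1 / e) = patch (shift y S) 0 (1 / e))}"
    by (rule Collect_cong) metis
  then show ?thesis unfolding tiling_dist_def by simp
qed

lemma tiling_dist_nonneg: "0 \<le> tiling_dist S T"
  unfolding tiling_dist_def by (intro cInf_greatest) auto

lemma tiling_dist_le: "tiling_dist S T \<le> 1 / sqrt 2"
  unfolding tiling_dist_def by (intro cInf_lower bdd_belowI[of _ 0]) auto

lemma tiling_distI:
  assumes "0 < e" "norm x \<le> e" "norm y \<le> e" "agree (shift x S) (shift y T) 0 (1 / e)"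
  shows "tiling_dist S T \<le> e"
  unfolding tiling_dist_def using assms
  by (intro cInf_lower bdd_belowI[of _ 0]) (auto simp: agree_def)

text \<open>The translations relating \<open>S\<close> to \<open>T\<close> and \<open>T\<close> to \<open>U\<close> compose to a relative displacement of
  \<open>S\<close> and \<open>U\<close> of norm up to \<open>2 * (a + b)\<close>, which has to be distributed between \<open>S\<close> and \<open>U\<close> so that
  each receives at most \<open>a + b\<close> while the ball of agreement, of radius \<open>1 / a\<close>, moves by no more than
  \<open>1 / a - 1 / (a + b)\<close>. The bound \<open>1 / sqrt 2\<close> on the distance leaves room for a move by \<open>b\<close>.\<close>

lemma tiling_dist_triangle_aux:
  fixes S T U :: "('a::euclidean_space, 'l) tiling"
  assumes b: "0 < b" "b \<le> a" and c: "a + b < 1 / sqrt 2"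
    and x: "norm x1 \<le> a" "norm x2 \<le> a" "agree (shift x1 S) (shift x2 T) 0 (1 / a)"
    and y: "norm y2 \<le> b" "norm y3 \<le> b" "agree (shift y2 T) (shift y3 U) 0 (1 / b)"
  shows "tiling_dist S U \<le> a + b"
proof -
  define q where "q = y3 - y2 + x2"
\<comment> \<open>The part of \<open>q\<close> charged to \<open>S\<close>: as much of \<open>q\<close> as fits into the ball of radius \<open>b\<close>.\<close>
  define p where "p = (if norm q \<le> b then q else (b / norm q) *\<^sub>R q)"
  have q: "norm q \<le> a + 2 * b"
    unfolding q_def using x(2) y(1,2) norm_triangle_ineq4[of y3 y2] norm_triangle_ineq[of "y3 - y2" x2] by linarith
  have p: "norm p \<le> b"
    using b by (auto simp: p_def)
  have qp: "norm (q - p) \<le> a + b"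
  proof (cases "norm q \<le> b")
    case True then show ?thesis using b by (simp add: p_def)
  next
    case False
    then have "q - p = ((norm q - b) / norm q) *\<^sub>R q"
      using b by (auto simp: p_def algebra_simps diff_divide_distrib)
    then have "norm (q - p) = norm q - b"
      using False b by auto
    then show ?thesis using q by simp
  qed
  have c2: "(a + b) * (a + b) \<le> 1 / 2"
  proof -
    have "(a + b)^2 \<le> (1 / sqrt 2)^2" using b c by (intro power_mono) auto
    then show ?thesis by (simp add: power_divide power2_eq_square)
  qed
  have a0: "0 < a" using b by simp
  have "agree (shift (- p) (shift x1 S)) (shift (- p) (shift x2 T)) p (1 / a)"
    unfolding agree_shift using x(3) by simp
  then have 1: "agree (shift (x1 - p) S) (shift (x2 - p) T) p (1 / a)"
    by (simp add: algebra_simps)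
  have "agree (shift (x2 - y2 - p) (shift y2 T)) (shift (x2 - y2 - p) (shift y3 U)) (y2 - x2 + p) (1 / b)"
    unfolding agree_shift using y(3) by simp
  then have 2: "agree (shift (x2 - p) T) (shift (q - p) U) (y2 - x2 + p) (1 / b)"
    by (simp add: algebra_simps q_def)
  have "a * (a + b) \<le> 1"
    using c2 b a0 mult_mono[of a "a + b" "a + b" "a + b"] by linarith
  then have "b * (a * (a + b)) \<le> b * 1"
    using b by (intro mult_left_mono) auto
  then have "b + 1 / (a + b) \<le> 1 / a"
    using a0 b by (simp add: field_simps)
  then have 3: "agree (shift (x1 - p) S) (shift (x2 - p) T) 0 (1 / (a + b))"
    using p by (intro agree_mono[OF 1]) simp
  have "(a + b) * (a + 2 * b) \<le> 2 * ((a + b) * (a + b))"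
    using b a0 by (simp add: algebra_simps)
  then have "(a + b) * (a + 2 * b) \<le> 1" using c2 by linarith
  then have "b * ((a + b) * (a + 2 * b)) \<le> b * 1"
    using b by (intro mult_left_mono) auto
  moreover have "(a + 2 * b) * (b * (a + b)) = b * ((a + b) * (a + 2 * b))"
    by (simp add: algebra_simps)
  ultimately have "(a + 2 * b) * (b * (a + b)) \<le> a" using b by linarith
  then have "a + 2 * b \<le> a / (b * (a + b))" using a0 b by (simp add: pos_le_divide_eq)
  also have "a / (b * (a + b)) = 1 / b - 1 / (a + b)"
    using a0 b by (simp add: field_simps)
  finally have "a + 2 * b + 1 / (a + b) \<le> 1 / b" by simp
  moreover have "norm (y2 - x2 + p) \<le> a + 2 * b"
    using p x(2) y(1) norm_triangle_ineq4[of y2 x2] norm_triangle_ineq[of "y2 - x2" p] by linarith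
  ultimately have "agree (shift (x2 - p) T) (shift (q - p) U) 0 (1 / (a + b))"
    by (intro agree_mono[OF 2]) simp
  from agree_trans[OF 3 this] show ?thesis
    using qp p x(1) norm_triangle_ineq4[of x1 p] a0 b
    by (intro tiling_distI[of _ "x1 - p" "q - p"]) auto
qed

lemma tiling_dist_triangle: "tiling_dist S U \<le> tiling_dist S T + tiling_dist T U"
proof (rule ccontr)
  assume "\<not> ?thesis"
  then have less: "tiling_dist S T + tiling_dist T U < tiling_dist S U" by simp
  define h where "h = (tiling_dist S U - (tiling_dist S T + tiling_dist T U)) / 2"
  have h: "0 < h" "tiling_dist S T + h + (tiling_dist T U + h) \<le> tiling_dist S U"
    using less by (auto simp: h_def field_simps)
  have small: "tiling_dist S T + h \<le> 1 / sqrt 2" "tiling_dist T U + h \<le> 1 / sqrt 2"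
    using h tiling_dist_le[of S U] tiling_dist_nonneg[of S T] tiling_dist_nonneg[of T U] by linarith+
  obtain a x1 x2 where a: "0 < a" "a < tiling_dist S T + h" "norm x1 \<le> a" "norm x2 \<le> a"
    "agree (shift x1 S) (shift x2 T) 0 (1 / a)"
    using tiling_dist_less[of S T "tiling_dist S T + h"] h small by auto
  obtain b y2 y3 where b: "0 < b" "b < tiling_dist T U + h" "norm y2 \<le> b" "norm y3 \<le> b"
    "agree (shift y2 T) (shift y3 U) 0 (1 / b)"
    using tiling_dist_less[of T U "tiling_dist T U + h"] h small by auto
  have ab: "a + b < tiling_dist S U" using a b h by linarith
  have lt: "a + b < 1 / sqrt 2" using ab tiling_dist_le[of S U] by linarith
  have "tiling_dist S U \<le> a + b"
  proof (cases "b \<le> a")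
    case True
    then show ?thesis using tiling_dist_triangle_aux[OF b(1) True lt a(3-5) b(3-5)] by simp
  next
    case False
    then have "tiling_dist U S \<le> b + a"
      using tiling_dist_triangle_aux[OF a(1) _ _ b(4,3) agree_sym[OF b(5)] a(4,3) agree_sym[OF a(5)]] lt
      by simp
    then show ?thesis by (simp add: tiling_dist_commute add.commute)
  qed
  with ab show False by simp
qed

lemma is_tile_nonempty: "is_tile t \<Longrightarrow> fst t \<noteq> {}"
  unfolding is_tile_def by (metis homeomorphic_empty(2) cball_eq_empty not_one_less_zero)

text \<open>Each of the finitely many prototiles contains a ball; the smallest radius \<open>\<kappa>\<close> works, because a
  tile and its translate by less than \<open>\<kappa>\<close> have overlapping interiors, so they are equal as
  tiles of one tiling, and a nonempty bounded set is not invariant under a nonzero translation.\<close>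

lemma rigid_prototiles:
  fixes \<P> :: "('a::euclidean_space, 'l) tile set set"
  assumes "prototile_set \<P>"
  obtains \<kappa> where "0 < \<kappa>" "\<And>T. is_tiling \<P> T \<Longrightarrow> rigid \<kappa> T"
proof -
  have ball: "\<exists>r>0. \<forall>t. is_tile t \<and> tile_class t = p \<longrightarrow> (\<exists>c. ball c r \<subseteq> fst t)" if "p \<in> \<P>" for p
  proof -
    have "\<forall>p\<in>\<P>. \<exists>s. is_tile s \<and> p = tile_class s"
      using assms unfolding prototile_set_def by (rule conjunct2)
    from bspec[OF this that] obtain s where s: "is_tile s" "p = tile_class s"
      by (elim exE conjE)
    have "interior (fst s) \<noteq> {}"
      using s(1) is_tile_nonempty[OF s(1)] unfolding is_tile_def by force
    then obtain c r where r: "0 < r" "ball c r \<subseteq> fst s"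
      by (auto simp: mem_interior)
    have "\<exists>c. ball c r \<subseteq> fst t" if t: "tile_class t = p" for t
    proof -
      have "t \<in> tile_class t" unfolding tile_class_def by (auto intro: range_eqI[of _ _ 0])
      then obtain x where x: "t = tile_shift x s"
        using t s(2) by (auto simp: tile_class_def)
      have "ball (c - x) r \<subseteq> fst t"
      proof
        fix y assume "y \<in> ball (c - x) r"
        then have "y + x \<in> ball c r" by (simp add: dist_norm algebra_simps)
        then show "y \<in> fst t" using r x by (auto simp: fst_tile_shift)
      qed
      then show ?thesis by blast
    qed
    then show ?thesis using r(1) by blast
  qed
  then obtain r where r: "\<And>p. p \<in> \<P> \<Longrightarrow> 0 < r p"
     "\<And>p t. p \<in> \<P> \<Longrightarrow> is_tile t \<Longrightarrow> tile_class t = p \<Longrightarrow> \<exists>c. ball c (r p) \<subseteq> fst t"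
    by metis
  define \<kappa> where "\<kappa> = Min (insert 1 (r ` \<P>))"
  have fin: "finite \<P>" using assms by (simp add: prototile_set_def)
  have \<kappa>: "0 < \<kappa>" "\<And>p. p \<in> \<P> \<Longrightarrow> \<kappa> \<le> r p"
    using fin r(1) by (auto simp: \<kappa>_def)
  have "rigid \<kappa> T" if T: "is_tiling \<P> T" for T
    unfolding rigid_def
  proof (intro conjI ballI allI impI)
    show "(\<Union>t\<in>T. fst t) = UNIV" using T by (simp add: is_tiling_def)
  next
    fix t assume "t \<in> T"
    then have "is_tile t" using T unfolding is_tiling_def by auto
    then show "fst t \<noteq> {}" by (rule is_tile_nonempty)
  next
    fix t u assume t: "t \<in> T" and u: "norm u < \<kappa>" and tu: "tile_shift u t \<in> T"
    have tile: "is_tile t" "tile_class t \<in> \<P>" using T t by (auto simp: is_tiling_def)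
    then obtain c where c: "ball c (r (tile_class t)) \<subseteq> fst t" using r(2) by blast
    then have c: "ball c \<kappa> \<subseteq> fst t"
      using \<kappa>(2)[OF tile(2)] by (meson order_trans subset_ball)
    have "ball c \<kappa> \<inter> ball (c - u) \<kappa> \<subseteq> fst t \<inter> fst (tile_shift u t)"
    proof
      fix y assume y: "y \<in> ball c \<kappa> \<inter> ball (c - u) \<kappa>"
      then have "y + u \<in> ball c \<kappa>" by (simp add: dist_norm algebra_simps)
      then show "y \<in> fst t \<inter> fst (tile_shift u t)"
        using c y by (auto simp: fst_tile_shift)
    qed
    then have "ball c \<kappa> \<inter> ball (c - u) \<kappa> \<subseteq> interior (fst t \<inter> fst (tile_shift u t))"
      by (intro interior_maximal) auto
    moreover have "c \<in> ball c \<kappa> \<inter> ball (c - u) \<kappa>"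
      using u \<kappa>(1) by (simp add: dist_norm)
    ultimately have "interior (fst t \<inter> fst (tile_shift u t)) \<noteq> {}" by blast
    then have eq: "tile_shift u t = t"
      using T t tu unfolding is_tiling_def by metis
    have "c \<in> fst t" using c \<kappa>(1) by auto
\<comment> \<open>Equality of \<open>t\<close> and \<open>t - u\<close> would put an unbounded orbit of \<open>c\<close> into the compact support.\<close>
    have iter: "c + real n *\<^sub>R u \<in> fst t" for n
    proof (induction n)
      case 0 then show ?case using \<open>c \<in> fst t\<close> by simp
    next
      case (Suc n)
      then have "c + real n *\<^sub>R u \<in> fst (tile_shift u t)" using eq by simp
      then show ?case by (simp add: fst_tile_shift algebra_simps)
    qed
    obtain B where B: "\<And>y. y \<in> fst t \<Longrightarrow> norm y \<le> B"
      using tile(1) compact_imp_bounded[of "fst t"] unfolding is_tile_def bounded_iff by blast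
    show "u = 0"
    proof (rule ccontr)
      assume "u \<noteq> 0"
      obtain n where n: "(B + norm c) / norm u < real n" using reals_Archimedean2 by blast
      have "real n * norm u \<le> norm (c + real n *\<^sub>R u) + norm c"
        using norm_triangle_ineq4[of "c + real n *\<^sub>R u" c] by simp
      then have "real n * norm u \<le> B + norm c" using B[OF iter[of n]] by linarith
      with n \<open>u \<noteq> 0\<close> show False by (simp add: field_simps)
    qed
  qed
  then show thesis using that \<kappa>(1) by blast
qed

text \<open>A tile of \<open>S\<close> has arbitrarily small translates in \<open>T\<close>. By rigidity they are all the same
  tile, and hence the displacement is zero.\<close>

lemma tiling_dist_eq_0_subset:
  assumes "rigid \<kappa> S" and T: "rigid \<kappa> T" "0 < \<kappa>" and "tiling_dist S T = 0"
  shows "S \<subseteq> T"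
proof
  fix t assume "t \<in> S"
  then obtain y where y: "y \<in> fst t" using assms(1) unfolding rigid_def by blast
    have "\<exists>w. norm w \<le> e \<and> tile_shift w t \<in> T" if "0 < e" "e \<le> 1 / (norm y + 2)" for e
    proof -
      have "1 / (norm y + 2) \<le> 1 / 2" by (rule frac_le) auto
      then have e: "e \<le> 1 / 2" using that(2) by linarith
      have "near e S T"
        using tiling_dist_near[of S T "e / 2"] assms(4) that e by simp
      then obtain w where w: "norm w \<le> e" "agree (shift w S) T 0 (1 / e)"
        by (auto simp: near_def)
      have "y - w \<in> fst (tile_shift w t)" using y by (simp add: fst_tile_shift)
      moreover have "0 < norm y + 2" by (simp add: add_nonneg_pos)
      then have "norm y + 2 \<le> 1 / e"
        using that by (simp add: pos_le_divide_eq mult.commute)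
      then have "dist 0 (y - w) < 1 / e"
        using norm_triangle_ineq4[of y w] w(1) e by simp
      ultimately have "tile_shift w t \<in> T"
        using agreeD[OF w(2), of "y - w" "tile_shift w t"] \<open>t \<in> S\<close> by (simp add: mem_shift_iff)
      with w(1) show ?thesis by blast
    qed
    note ex = this
    define e where "e = min (1 / (norm y + 2)) (\<kappa> / 3)"
    have e: "0 < e" "e \<le> 1 / (norm y + 2)" "e \<le> \<kappa> / 3"
      using \<open>0 < \<kappa>\<close> by (auto simp: e_def add_nonneg_pos)
    obtain w where w: "norm w \<le> e" "tile_shift w t \<in> T" using ex e by blast
    have "w = 0"
    proof (rule ccontr)
      assume "w \<noteq> 0"
      then obtain v where v: "norm v \<le> norm w / 2" "tile_shift v t \<in> T"
        using ex[of "norm w / 2"] w(1) e by auto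
      have "norm (v - w) < \<kappa>" using norm_triangle_ineq4[of v w] v w e \<open>0 < \<kappa>\<close> by linarith
      moreover have "tile_shift (v - w) (tile_shift w t) \<in> T" using v by simp
      ultimately have "v = w" using T w(2) by (force simp: rigid_def)
      with v \<open>w \<noteq> 0\<close> show False by simp
    qed
    then show "t \<in> T" using w by simp
qed

text \<open>The topology on tilings is that of an abstract metric space, so its open sets can be described
  by balls only once the distance is known to be a metric.\<close>

lemma Metric_space_tilings:
  fixes \<P> :: "('a::euclidean_space, 'b) tile set set"
  assumes "prototile_set \<P>"
  shows "Metric_space {T. is_tiling \<P> T} tiling_dist"
proof
  fix S T assume *: "S \<in> {T. is_tiling \<P> T}" "T \<in> {T. is_tiling \<P> T}"
  obtain \<kappa> where \<kappa>: "0 < \<kappa>" "\<And>T. is_tiling \<P> T \<Longrightarrow> rigid \<kappa> T"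
    using rigid_prototiles[OF assms] by blast
  show "(tiling_dist S T = 0) = (S = T)"
  proof
    assume 0: "tiling_dist S T = 0"
    have "S \<subseteq> T"
      using tiling_dist_eq_0_subset[of \<kappa> S T] * \<kappa> 0 by simp
    moreover have "T \<subseteq> S"
      using tiling_dist_eq_0_subset[of \<kappa> T S] * \<kappa> 0 by (simp add: tiling_dist_commute)
    ultimately show "S = T" by blast
  next
    assume "S = T"
    have "tiling_dist S T \<le> 0 + e" if "0 < e" for e
    proof -
      have "near e S T" using near_shift[of 0 e S] that \<open>S = T\<close> by simp
      then show ?thesis using near_tiling_dist that by simp
    qed
    then have "tiling_dist S T \<le> 0" by (rule field_le_epsilon)
    then show "tiling_dist S T = 0" using tiling_dist_nonneg[of S T] by simp
  qed
next
  fix S T U :: "('a, 'b) tiling"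
  show "0 \<le> tiling_dist S T" by (rule tiling_dist_nonneg)
  show "tiling_dist S T = tiling_dist T S" by (rule tiling_dist_commute)
  show "tiling_dist S U \<le> tiling_dist S T + tiling_dist T U" by (rule tiling_dist_triangle)
qed

section \<open>Paths of tilings\<close>

lemma chain_convex:
  fixes A :: "'v::real_normed_vector set"
  assumes "convex A" "a \<in> A" "b \<in> A" "P a" "0 < \<delta>"
    and step: "\<And>x y. x \<in> A \<Longrightarrow> y \<in> A \<Longrightarrow> dist x y < \<delta> \<Longrightarrow> P x \<Longrightarrow> P y"
  shows "P b"
proof (rule connected_induction_simple[OF convex_connected[OF \<open>convex A\<close>] assms(2,3)])
  show "P a" by fact
  fix x assume "x \<in> A"
  show "\<exists>T. openin (top_of_set A) T \<and> x \<in> T \<and> (\<forall>y\<in>T. \<forall>z\<in>T. P y \<longrightarrow> P z)"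
  proof (intro exI[of _ "A \<inter> ball x (\<delta> / 2)"] conjI ballI impI)
    fix y z assume "y \<in> A \<inter> ball x (\<delta> / 2)" "z \<in> A \<inter> ball x (\<delta> / 2)" "P y"
    then show "P z"
      using step[of y z] dist_triangle_half_r[of x y \<delta> z] by simp
  qed (use \<open>x \<in> A\<close> \<open>0 < \<delta>\<close> in \<open>auto simp: openin_open_Int\<close>)
qed

definition tiling_path :: "real \<Rightarrow> (real \<Rightarrow> ('a::euclidean_space, 'l) tiling) \<Rightarrow> bool" where
  "tiling_path L \<gamma> \<longleftrightarrow>
     (\<forall>e>0. \<exists>d>0. \<forall>s\<in>{0..L}. \<forall>t\<in>{0..L}. \<bar>s - t\<bar> < d \<longrightarrow> near e (\<gamma> s) (\<gamma> t))"

text \<open>A tiling near \<open>\<gamma> a\<close> need not be a translate of \<open>\<gamma> a\<close>, since the two agree only on a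
  bounded ball. On a path, however, let \<open>w s\<close> be the small displacement from \<open>\<gamma> a\<close> to \<open>\<gamma> s\<close>. For
  each \<open>R\<close>, agreement of \<open>\<gamma> s\<close> translated back by \<open>w s\<close> with \<open>\<gamma> a\<close> on the ball of radius \<open>R\<close>
  around the origin is a locally constant property of \<open>s\<close>: nearby tilings of the path agree on a
  ball much larger than \<open>R\<close>, up to a displacement which is the increment of \<open>w\<close> by uniqueness.
  Starting from \<open>s = a\<close>, the property holds everywhere and for every \<open>R\<close>.\<close>

lemma short_path_in_orbit:
  fixes \<gamma> :: "real \<Rightarrow> ('a::euclidean_space, 'l) tiling"
  assumes cont: "\<And>e. 0 < e \<Longrightarrow> \<exists>d>0. \<forall>s\<in>{a..b}. \<forall>t\<in>{a..b}. \<bar>s - t\<bar> < d \<longrightarrow> near e (\<gamma> s) (\<gamma> t)"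
    and rig: "\<And>s. s \<in> {a..b} \<Longrightarrow> rigid \<kappa> (\<gamma> s)"
    and e: "0 < e" "e \<le> 1 / 2" "4 * e < \<kappa>"
    and close: "\<And>s. s \<in> {a..b} \<Longrightarrow> near e (\<gamma> a) (\<gamma> s)"
    and "a \<le> b"
  shows "\<exists>w. norm w \<le> e \<and> \<gamma> b = shift w (\<gamma> a)"
proof -
  have "\<forall>s\<in>{a..b}. \<exists>w. norm w \<le> e \<and> agree (shift w (\<gamma> a)) (\<gamma> s) 0 (1 / e)"
    using close by (simp add: near_def)
  then obtain w where w: "\<And>s. s \<in> {a..b} \<Longrightarrow> norm (w s) \<le> e"
    "\<And>s. s \<in> {a..b} \<Longrightarrow> agree (shift (w s) (\<gamma> a)) (\<gamma> s) 0 (1 / e)"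
    by metis
  have ab: "a \<in> {a..b}" "b \<in> {a..b}" using \<open>a \<le> b\<close> by auto
  have wa: "w a = 0"
    using displacement_unique[of \<kappa> "\<gamma> a" "\<gamma> a" "w a" 0 "1/e" 0 0 0 1] w ab rig e by force
  have agr: "agree (shift (- w b) (\<gamma> b)) (\<gamma> a) 0 R" if "0 < R" for R
  proof -
    define e1 where "e1 = min e (1 / (R + 1))"
    have e1: "0 < e1" "e1 \<le> e" "R + 1 \<le> 1 / e1"
      using e \<open>0 < R\<close> by (auto simp: e1_def min_def field_simps)
    obtain d where d: "0 < d" "\<And>s t. s \<in> {a..b} \<Longrightarrow> t \<in> {a..b} \<Longrightarrow> \<bar>s - t\<bar> < d \<Longrightarrow> near e1 (\<gamma> s) (\<gamma> t)"
      using cont[OF e1(1)] by blast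
    show ?thesis
    proof (rule chain_convex[of "{a..b}" a b "\<lambda>s. agree (shift (- w s) (\<gamma> s)) (\<gamma> a) 0 R" d])
      show "agree (shift (- w a) (\<gamma> a)) (\<gamma> a) 0 R" by (simp add: wa)
    next
      fix s t assume st: "s \<in> {a..b}" "t \<in> {a..b}" "dist s t < d"
        and IH: "agree (shift (- w s) (\<gamma> s)) (\<gamma> a) 0 R"
      obtain v where v: "norm v \<le> e1" "agree (shift v (\<gamma> s)) (\<gamma> t) 0 (1 / e1)"
        using d(2)[OF st(1,2)] st(3) by (auto simp: near_def dist_real_def)
      have "agree (shift v (shift (w s) (\<gamma> a))) (shift v (\<gamma> s)) (- v) (1 / e)"
        unfolding agree_shift using w(2)[OF st(1)] by simp
      then have 1: "agree (shift (v + w s) (\<gamma> a)) (shift v (\<gamma> s)) (- v) (1 / e)" by simp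
      have e2: "1 + norm v \<le> 1 / e" "1 \<le> 1 / e1"
        using v(1) e1 e \<open>0 < R\<close> order_trans[of "1 + norm v" 2 "1 / e"] by (auto simp: field_simps)
      have 2: "agree (shift (v + w s) (\<gamma> a)) (\<gamma> t) 0 1"
        using agree_mono[OF 1, of 0 1] agree_mono[OF v(2), of 0 1] e2 by (auto intro: agree_trans)
      have "norm (v + w s - w t) \<le> e1 + e + e"
        using v(1) w(1)[OF st(1)] w(1)[OF st(2)] norm_triangle_ineq4[of "v + w s" "w t"] norm_triangle_ineq[of v "w s"]
        by linarith
      then have eq: "v + w s = w t"
        using displacement_unique[OF rig[OF ab(1)] rig[OF st(2)] 2 _ w(2)[OF st(2)], of 0] e e1 by simp
      have "agree (shift (- w t) (shift v (\<gamma> s))) (shift (- w t) (\<gamma> t)) (w t) (1 / e1)"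
        unfolding agree_shift using v(2) by simp
      then have 3: "agree (shift (- w s) (\<gamma> s)) (shift (- w t) (\<gamma> t)) (w t) (1 / e1)"
        using eq[symmetric] by simp
      have "norm (w t) \<le> 1" using w(1)[OF st(2)] e by simp
      then have "agree (shift (- w s) (\<gamma> s)) (shift (- w t) (\<gamma> t)) 0 R"
        using e1 by (intro agree_mono[OF 3]) simp
      then show "agree (shift (- w t) (\<gamma> t)) (\<gamma> a) 0 R"
        using IH agree_sym agree_trans by blast
    qed (use ab d(1) in auto)
  qed
  have "shift (- w b) (\<gamma> b) = \<gamma> a"
    using agree_everywhere[OF rigid_shift[OF rig[OF ab(2)]] rig[OF ab(1)] agr] .
  then have "shift (w b) (\<gamma> a) = \<gamma> b" by (metis add.right_inverse shift_0 shift_shift)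
  then show ?thesis using w(1)[OF ab(2)] by metis
qed

lemma tiling_path_sub:
  assumes "tiling_path L \<gamma>" "0 \<le> a" "b \<le> L" "0 < e"
  shows "\<exists>d>0. \<forall>s\<in>{a..b}. \<forall>t\<in>{a..b}. \<bar>s - t\<bar> < d \<longrightarrow> near e (\<gamma> s) (\<gamma> t)"
proof -
  have "{a..b} \<subseteq> {0..L}" using assms(2,3) by auto
  then show ?thesis using assms(1,4) unfolding tiling_path_def by (meson subsetD)
qed

text \<open>The third clause says that the lift inherits every modulus of continuity of the path that is valid
  at a scale \<open>e\<close> below the rigidity constant. It yields both the continuity of the lift and the
  linear bound on its growth.\<close>

definition is_lift :: "real \<Rightarrow> real \<Rightarrow> (real \<Rightarrow> ('a::euclidean_space, 'l) tiling) \<Rightarrow> (real \<Rightarrow> 'a) \<Rightarrow> bool" where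
  "is_lift \<kappa> L \<gamma> \<phi> \<longleftrightarrow> \<phi> 0 = 0 \<and> (\<forall>s\<in>{0..L}. \<gamma> s = shift (\<phi> s) (\<gamma> 0)) \<and>
     (\<forall>e d. 0 < e \<longrightarrow> e \<le> 1 / 2 \<longrightarrow> 4 * e < \<kappa> \<longrightarrow>
        (\<forall>s\<in>{0..L}. \<forall>t\<in>{0..L}. \<bar>s - t\<bar> < d \<longrightarrow> near e (\<gamma> s) (\<gamma> t)) \<longrightarrow>
        (\<forall>s\<in>{0..L}. \<forall>t\<in>{0..L}. \<bar>s - t\<bar> < d \<longrightarrow> norm (\<phi> s - \<phi> t) \<le> e))"

text \<open>The path is cut into pieces of length \<open>d\<close>, short enough for \<open>short_path_in_orbit\<close>, and the
  displacements of the pieces are added up. This gives a lift that varies by at most \<open>3 * \<eta>\<close> over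
  distances below \<open>d\<close>. For a finer or longer range the estimate comes from \<open>short_path_in_orbit\<close>
  applied from \<open>s\<close>: the displacement found there agrees with the increment of the lift, as both start at
  zero and uniqueness propagates the equality in steps of length \<open>d\<close>.\<close>

lemma orbit_lift:
  fixes \<gamma> :: "real \<Rightarrow> ('a::euclidean_space, 'l) tiling"
  assumes path: "tiling_path L \<gamma>" and rig: "\<And>s. s \<in> {0..L} \<Longrightarrow> rigid \<kappa> (\<gamma> s)"
    and "0 < \<kappa>" "0 \<le> L"
  obtains \<phi> where "is_lift \<kappa> L \<gamma> \<phi>"
proof -
  have self: "w = 0" if "s \<in> {0..L}" "\<gamma> s = shift w (\<gamma> s)" "norm w < \<kappa>" for s w
    using displacement_unique[of \<kappa> "\<gamma> s" "\<gamma> s" w 0 1 0 0 0 1] that rig by simp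
  define \<eta> where "\<eta> = min (1 / 2) (\<kappa> / 8)"
  have \<eta>: "0 < \<eta>" "\<eta> \<le> 1 / 2" "8 * \<eta> \<le> \<kappa>" using \<open>0 < \<kappa>\<close> by (auto simp: \<eta>_def min_def)
  obtain d0 where d0: "0 < d0" "\<And>s t. s \<in> {0..L} \<Longrightarrow> t \<in> {0..L} \<Longrightarrow> \<bar>s - t\<bar> < d0 \<Longrightarrow> near \<eta> (\<gamma> s) (\<gamma> t)"
    using path \<eta>(1) unfolding tiling_path_def by blast
  have step: "\<exists>w. norm w \<le> e \<and> \<gamma> t = shift w (\<gamma> s)"
    if "0 < e" "e \<le> 1 / 2" "4 * e < \<kappa>"
      "\<And>s t. \<lbrakk>s \<in> {0..L}; t \<in> {0..L}; \<bar>s - t\<bar> < d\<rbrakk> \<Longrightarrow> near e (\<gamma> s) (\<gamma> t)"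
      "0 \<le> s" "s \<le> t" "t \<le> L" "t - s < d" for e d s t
    using that rig
    by (intro short_path_in_orbit[OF tiling_path_sub[OF path], where \<kappa> = \<kappa>]) auto
\<comment> \<open>\<open>V s t\<close> is the displacement from \<open>\<gamma> s\<close> to \<open>\<gamma> t\<close>, and \<open>x n\<close> sums it along the grid.\<close>
  define V where "V s t = (SOME w. norm w \<le> \<eta> \<and> \<gamma> t = shift w (\<gamma> s))" for s t
  have V: "norm (V s t) \<le> \<eta>" "\<gamma> t = shift (V s t) (\<gamma> s)" if "0 \<le> s" "s \<le> t" "t \<le> L" "t - s < d0" for s t
  proof -
    have "\<exists>w. norm w \<le> \<eta> \<and> \<gamma> t = shift w (\<gamma> s)"
      using that \<eta> d0 \<open>0 < \<kappa>\<close> by (intro step[of _ d0]) auto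
    then show "norm (V s t) \<le> \<eta>" "\<gamma> t = shift (V s t) (\<gamma> s)"
      unfolding V_def by (metis (mono_tags, lifting) someI_ex)+
  qed
  define d where "d = d0 / 2"
  have d: "0 < d" "d < d0" using d0(1) by (auto simp: d_def)
  define x where "x n = (\<Sum>i<n. V (real i * d) (real (Suc i) * d))" for n
  have x: "\<gamma> (real n * d) = shift (x n) (\<gamma> 0)" if "real n * d \<le> L" for n
    using that
  proof (induction n)
    case 0 then show ?case by (simp add: x_def)
  next
    case (Suc n)
    have "real n * d \<le> real (Suc n) * d" using d(1) by simp
    then have IH: "\<gamma> (real n * d) = shift (x n) (\<gamma> 0)" using Suc by linarith
    have "\<gamma> (real (Suc n) * d) = shift (V (real n * d) (real (Suc n) * d)) (\<gamma> (real n * d))"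
      using d Suc.prems by (intro V) (auto simp: algebra_simps)
    then show ?case using IH by (simp add: x_def add.commute)
  qed
  define N where "N s = nat \<lfloor>s / d\<rfloor>" for s
  have N: "real (N s) * d \<le> s" "s < real (N s) * d + d" if "0 \<le> s" for s
  proof -
    have "real (N s) = of_int \<lfloor>s / d\<rfloor>" using that d(1) by (simp add: N_def)
    then have "real (N s) \<le> s / d" "s / d < real (N s) + 1" by linarith+
    then show "real (N s) * d \<le> s" "s < real (N s) * d + d"
      using d(1) by (simp_all add: field_simps)
  qed
  define \<phi> where "\<phi> s = x (N s) + V (real (N s) * d) s" for s
  have \<phi>: "\<gamma> s = shift (\<phi> s) (\<gamma> 0)" if "s \<in> {0..L}" for s
  proof -
    have "\<gamma> s = shift (V (real (N s) * d) s) (\<gamma> (real (N s) * d))"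
      using that d N[of s] by (intro V) auto
    then show ?thesis
      using x[of "N s"] N[of s] that by (simp add: \<phi>_def add.commute)
  qed
  have \<phi>0: "\<phi> 0 = 0"
  proof -
    have "N 0 = 0" by (simp add: N_def)
    moreover have "V 0 0 = 0" using V[of 0 0] \<open>0 \<le> L\<close> d0(1) \<eta> \<open>0 < \<kappa>\<close> self[of 0 "V 0 0"] by auto
    ultimately show ?thesis by (simp add: \<phi>_def x_def)
  qed
  have coarse1: "norm (\<phi> s - \<phi> t) \<le> 3 * \<eta>" if "0 \<le> s" "s \<le> t" "t \<le> L" "t - s < d" for s t
  proof -
    have Ns: "norm (V (real (N s) * d) s) \<le> \<eta>" "norm (V (real (N t) * d) t) \<le> \<eta>"
      using that d N[of s] N[of t] by (auto intro!: V(1))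
    have "real (N s) * d < (real (N t) + 1) * d" using that N[of s] N[of t] by (simp add: algebra_simps)
    then have "N s \<le> N t" using d(1) by simp
    moreover have "real (N t) * d < (real (N s) + 2) * d" using that N[of s] N[of t] by (simp add: algebra_simps)
    then have "real (N t) < real (N s) + 2" using d(1) by simp
    ultimately consider "N t = N s" | "N t = Suc (N s)" by linarith
    then show ?thesis
    proof cases
      case 1
      then show ?thesis
        using Ns norm_triangle_ineq4[of "V (real (N s) * d) s" "V (real (N t) * d) t"] \<eta> by (simp add: \<phi>_def)
    next
      case 2
      have "norm (V (real (N s) * d) (real (Suc (N s)) * d)) \<le> \<eta>"
        using d N[of t] that 2 by (intro V) (auto simp: algebra_simps)
      moreover have "\<phi> s - \<phi> t = V (real (N s) * d) s - V (real (N t) * d) t - V (real (N s) * d) (real (Suc (N s)) * d)"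
        by (simp add: \<phi>_def 2 x_def)
      ultimately show ?thesis
        using Ns norm_triangle_ineq4[of "V (real (N s) * d) s" "V (real (N t) * d) t"]
          norm_triangle_ineq4[of "V (real (N s) * d) s - V (real (N t) * d) t" "V (real (N s) * d) (real (Suc (N s)) * d)"]
        by simp
    qed
  qed
  have coarse: "norm (\<phi> s - \<phi> t) \<le> 3 * \<eta>" if "s \<in> {0..L}" "t \<in> {0..L}" "\<bar>s - t\<bar> < d" for s t
    using coarse1[of s t] coarse1[of t s] that by (cases "s \<le> t") (auto simp: norm_minus_commute)
  have fine: "norm (\<phi> t - \<phi> s) \<le> e"
    if e: "0 < e" "e \<le> 1 / 2" "4 * e < \<kappa>"
      and near: "\<And>s t. \<lbrakk>s \<in> {0..L}; t \<in> {0..L}; \<bar>s - t\<bar> < d'\<rbrakk> \<Longrightarrow> near e (\<gamma> s) (\<gamma> t)"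
      and st: "0 \<le> s" "s \<le> t" "t \<le> L" "t - s < d'" for e d' s t
  proof -
    have "\<forall>r\<in>{s..t}. \<exists>w. norm w \<le> e \<and> \<gamma> r = shift w (\<gamma> s)"
      using step[OF e near] st by simp
    then obtain w where w: "\<And>r. r \<in> {s..t} \<Longrightarrow> norm (w r) \<le> e" "\<And>r. r \<in> {s..t} \<Longrightarrow> \<gamma> r = shift (w r) (\<gamma> s)"
      by metis
    have "w t = \<phi> t - \<phi> s"
    proof (rule chain_convex[of "{s..t}" s t "\<lambda>r. w r = \<phi> r - \<phi> s" d])
      have "norm (w s) < \<kappa>" using w(1)[of s] e st by simp
      then show "w s = \<phi> s - \<phi> s" using self[of s "w s"] w(2)[of s] st by simp
    next
      fix p q assume pq: "p \<in> {s..t}" "q \<in> {s..t}" "dist p q < d" "w p = \<phi> p - \<phi> s"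
      then have pq': "p \<in> {0..L}" "q \<in> {0..L}" "s \<in> {0..L}" using st by auto
      have "shift (\<phi> q - \<phi> s) (\<gamma> s) = \<gamma> q"
        using \<phi>[OF pq'(2)] \<phi>[OF pq'(3)] by simp
      moreover have "shift (w q) (\<gamma> s) = \<gamma> q" using w(2)[OF pq(2)] by (rule sym)
      moreover have "norm (w q - (\<phi> q - \<phi> s)) < \<kappa>"
      proof -
        have split: "w q - (\<phi> q - \<phi> s) = (w q - w p) + (\<phi> p - \<phi> q)" using pq(4) by simp
        have "norm (\<phi> p - \<phi> q) \<le> 3 * \<eta>"
          using coarse[OF pq'(1,2)] pq(3) by (simp add: dist_real_def)
        then show ?thesis
          unfolding split using w(1)[OF pq(1)] w(1)[OF pq(2)] e \<eta>
            norm_triangle_ineq4[of "w q" "w p"] norm_triangle_ineq[of "w q - w p" "\<phi> p - \<phi> q"]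
          by linarith
      qed
      ultimately show "w q = \<phi> q - \<phi> s"
        using displacement_unique[of \<kappa> "\<gamma> s" "\<gamma> q" "w q" 0 1 0 "\<phi> q - \<phi> s" 0 1]
          rig[OF pq'(2)] rig[OF pq'(3)] by simp
    qed (use st d in auto)
    then show ?thesis using w(1)[of t] st by simp
  qed
  have "norm (\<phi> s - \<phi> t) \<le> e"
    if e: "0 < e" "e \<le> 1 / 2" "4 * e < \<kappa>"
      and near: "\<forall>s\<in>{0..L}. \<forall>t\<in>{0..L}. \<bar>s - t\<bar> < d' \<longrightarrow> near e (\<gamma> s) (\<gamma> t)"
      and st: "s \<in> {0..L}" "t \<in> {0..L}" "\<bar>s - t\<bar> < d'" for e d' s t
  proof (cases "s \<le> t")
    case True
    then have "norm (\<phi> t - \<phi> s) \<le> e"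
      by (intro fine[OF e, of d' s t]) (use near st in auto)
    then show ?thesis by (simp add: norm_minus_commute)
  next
    case False
    then show "norm (\<phi> s - \<phi> t) \<le> e"
      by (intro fine[OF e, of d' t s]) (use near st in auto)
  qed
  then have "is_lift \<kappa> L \<gamma> \<phi>"
    unfolding is_lift_def using \<phi>0 \<phi> by blast
  then show thesis by (rule that)
qed

lemma lift_bound:
  fixes \<phi> :: "real \<Rightarrow> 'v::real_normed_vector"
  assumes "\<phi> 0 = 0" "0 < d" "0 \<le> e"
    and step: "\<And>s t. \<lbrakk>s \<in> {0..L}; t \<in> {0..L}; \<bar>s - t\<bar> < d\<rbrakk> \<Longrightarrow> norm (\<phi> s - \<phi> t) \<le> e"
    and t: "t \<in> {0..L}"
  shows "norm (\<phi> t) \<le> (2 * t / d + 1) * e"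
proof -
  have *: "norm (\<phi> t) \<le> real n * e" if "t \<in> {0..L}" "t \<le> real n * (d / 2)" for n t
    using that
  proof (induction n arbitrary: t)
    case 0 then show ?case using \<open>\<phi> 0 = 0\<close> by simp
  next
    case (Suc n)
    define r where "r = max 0 (t - d / 2)"
    have r: "r \<in> {0..L}" "\<bar>t - r\<bar> < d" "r \<le> real n * (d / 2)"
      using Suc.prems \<open>0 < d\<close> by (auto simp: r_def max_def algebra_simps)
    have "norm (\<phi> t) \<le> norm (\<phi> r) + norm (\<phi> t - \<phi> r)" by (metis add.commute norm_triangle_sub)
    also have "\<dots> \<le> real n * e + e"
      using Suc.IH[OF r(1,3)] step[OF Suc.prems(1) r(1,2)] by simp
    finally show ?case by (simp add: algebra_simps)
  qed
  define n where "n = nat \<lceil>2 * t / d\<rceil>"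
  have "0 \<le> 2 * t / d" using t \<open>0 < d\<close> by simp
  then have n: "2 * t / d \<le> real n" "real n \<le> 2 * t / d + 1" unfolding n_def by linarith+
  then have "t \<le> real n * (d / 2)" using \<open>0 < d\<close> by (simp add: field_simps)
  then have "norm (\<phi> t) \<le> real n * e" using * t by blast
  also have "\<dots> \<le> (2 * t / d + 1) * e" using n(2) \<open>0 \<le> e\<close> by (rule mult_right_mono)
  finally show ?thesis .
qed

section \<open>Transfer of separation along a homeomorphism\<close>

definition near_uniformly_continuous ::
    "('a::euclidean_space, 'l) tiling set \<Rightarrow> (('a, 'l) tiling \<Rightarrow> ('a, 'm) tiling) \<Rightarrow> bool" where
  "near_uniformly_continuous X f \<longleftrightarrow>
     (\<forall>e>0. \<exists>d>0. \<forall>S\<in>X. \<forall>T\<in>X. near d S T \<longrightarrow> near e (f S) (f T))"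

text \<open>Displacements at points of the ball less than \<open>1\<close> apart are tested on a common tile, so they
  coincide.\<close>

lemma translations_constant:
  fixes S T :: "('a::euclidean_space, 'l) tiling"
  assumes rig: "rigid \<kappa> S" "rigid \<kappa> T" and "0 < e" "e \<le> 1" "2 * e < \<kappa>" and "0 < r"
    and near: "\<And>s. s \<in> ball 0 r \<Longrightarrow> near e (shift s S) (shift s T)"
  obtains u where "norm u \<le> e" "\<And>s. s \<in> ball 0 r \<Longrightarrow> agree (shift u S) T s (1 / e)"
proof -
  have "\<exists>u. norm u \<le> e \<and> agree (shift u S) T s (1 / e)" if "s \<in> ball 0 r" for s
  proof -
    obtain u where u: "norm u \<le> e" "agree (shift u (shift s S)) (shift s T) 0 (1 / e)"
      using near[OF \<open>s \<in> ball 0 r\<close>] by (auto simp: near_def)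
    then have "agree (shift s (shift u S)) (shift s T) 0 (1 / e)" by (simp add: add.commute)
    then show ?thesis using u(1) unfolding agree_shift by auto
  qed
  then obtain u where u: "\<And>s. s \<in> ball 0 r \<Longrightarrow> norm (u s) \<le> e"
      "\<And>s. s \<in> ball 0 r \<Longrightarrow> agree (shift (u s) S) T s (1 / e)"
    by metis
  have e1: "1 \<le> 1 / e" using \<open>0 < e\<close> \<open>e \<le> 1\<close> by simp
  have const: "u s = u 0" if "s \<in> ball 0 r" for s
  proof (rule chain_convex[of "ball 0 r" 0 s "\<lambda>s. u s = u 0" 1])
    fix x y assume xy: "x \<in> ball 0 r" "y \<in> ball 0 r" "dist x y < 1" "u x = u 0"
    have "norm (u x - u y) < \<kappa>"
      using norm_triangle_ineq4[of "u x" "u y"] u(1)[OF xy(1)] u(1)[OF xy(2)] \<open>2 * e < \<kappa>\<close> by linarith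
    then have "u x = u y"
      using displacement_unique[OF rig u(2)[OF xy(1)] _ u(2)[OF xy(2)], of y] xy(3) e1 \<open>0 < e\<close> by simp
    then show "u y = u 0" using xy(4) by simp
  qed (use that \<open>0 < r\<close> in auto)
  show thesis
  proof (rule that[of "u 0"])
    show "norm (u 0) \<le> e" using u(1) \<open>0 < r\<close> by simp
    fix s :: 'a assume s: "s \<in> ball 0 r"
    show "agree (shift (u 0) S) T s (1 / e)" using u(2)[OF s] const[OF s] by simp
  qed
qed

lemma translation_path:
  assumes "norm v \<le> 1"
  shows "tiling_path L (\<lambda>s. shift (s *\<^sub>R v) T)"
  unfolding tiling_path_def
proof (intro allI impI)
  fix e :: real assume "0 < e"
  show "\<exists>d>0. \<forall>s\<in>{0..L}. \<forall>t\<in>{0..L}. \<bar>s - t\<bar> < d \<longrightarrow> near e (shift (s *\<^sub>R v) T) (shift (t *\<^sub>R v) T)"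
  proof (intro exI[of _ e] conjI ballI impI near_orbit)
    fix s t assume "\<bar>s - t\<bar> < e"
    have "norm (s *\<^sub>R v - t *\<^sub>R v) = \<bar>s - t\<bar> * norm v" by (simp flip: scaleR_diff_left)
    also have "\<dots> \<le> \<bar>s - t\<bar> * 1" using assms by (intro mult_left_mono) auto
    finally show "norm (s *\<^sub>R v - t *\<^sub>R v) \<le> e" using \<open>\<bar>s - t\<bar> < e\<close> by simp
  qed fact
qed

lemma tiling_path_image:
  assumes "near_uniformly_continuous X f" "tiling_path L \<gamma>" "\<And>s. s \<in> {0..L} \<Longrightarrow> \<gamma> s \<in> X"
  shows "tiling_path L (\<lambda>s. f (\<gamma> s))"
  unfolding tiling_path_def
proof (intro allI impI)
  fix e :: real assume "0 < e"
  then obtain d where d: "0 < d" "\<And>S T. S \<in> X \<Longrightarrow> T \<in> X \<Longrightarrow> near d S T \<Longrightarrow> near e (f S) (f T)"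
    using assms(1) unfolding near_uniformly_continuous_def by blast
  then obtain c where "0 < c" "\<And>s t. s \<in> {0..L} \<Longrightarrow> t \<in> {0..L} \<Longrightarrow> \<bar>s - t\<bar> < c \<Longrightarrow> near d (\<gamma> s) (\<gamma> t)"
    using assms(2) unfolding tiling_path_def by blast
  then show "\<exists>d>0. \<forall>s\<in>{0..L}. \<forall>t\<in>{0..L}. \<bar>s - t\<bar> < d \<longrightarrow> near e (f (\<gamma> s)) (f (\<gamma> t))"
    using d(2) assms(3) by (intro exI[of _ c]) simp
qed

lemma lift_continuous:
  assumes path: "tiling_path L \<gamma>" and "0 < \<kappa>"
    and lift: "is_lift \<kappa> L \<gamma> \<phi>"
    and "0 < e"
  obtains d where "0 < d" "\<And>s t. \<lbrakk>s \<in> {0..L}; t \<in> {0..L}; \<bar>s - t\<bar> < d\<rbrakk> \<Longrightarrow> norm (\<phi> s - \<phi> t) \<le> e"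
proof -
  define e' where "e' = min e (min (1 / 2) (\<kappa> / 8))"
  have e': "0 < e'" "e' \<le> e" "e' \<le> 1 / 2" "4 * e' < \<kappa>" using \<open>0 < e\<close> \<open>0 < \<kappa>\<close> by (auto simp: e'_def min_def)
  then obtain d where d: "0 < d" "\<forall>s\<in>{0..L}. \<forall>t\<in>{0..L}. \<bar>s - t\<bar> < d \<longrightarrow> near e' (\<gamma> s) (\<gamma> t)"
    using path unfolding tiling_path_def by blast
  show thesis
  proof (rule that[OF d(1)])
    fix s t assume "s \<in> {0..L}" "t \<in> {0..L}" "\<bar>s - t\<bar> < d"
    then have "norm (\<phi> s - \<phi> t) \<le> e'"
      using lift e'(1,3,4) d(2) unfolding is_lift_def by blast
    then show "norm (\<phi> s - \<phi> t) \<le> e" using e'(2) by simp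
  qed
qed

text \<open>This is the heart of the proof, in the form of a contraposed separation estimate. The constant \<open>K\<close>
  comes from the growth of the lift of \<open>g\<close> along a straight line: each step of length \<open>d2 / 2\<close> in
  \<open>Y\<close> moves the lift by at most \<open>e2 \<le> 1 / 2\<close>.\<close>

lemma separation_transfer:
  fixes X :: "('a::euclidean_space, 'l) tiling set" and Y :: "('a, 'm) tiling set"
  assumes "0 < \<kappa>" and X: "\<And>T. T \<in> X \<Longrightarrow> rigid \<kappa> T" "\<And>x T. T \<in> X \<Longrightarrow> shift x T \<in> X"
    and Y: "\<And>T. T \<in> Y \<Longrightarrow> rigid \<kappa> T" "\<And>x T. T \<in> Y \<Longrightarrow> shift x T \<in> Y"
    and f: "near_uniformly_continuous X f" "\<And>T. T \<in> X \<Longrightarrow> f T \<in> Y"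
    and g: "near_uniformly_continuous Y g" "\<And>T. T \<in> Y \<Longrightarrow> g T \<in> X" "\<And>T. T \<in> Y \<Longrightarrow> f (g T) = T"
    and "0 < \<epsilon>"
  shows "\<exists>\<delta>>0. \<exists>K>0. \<forall>r\<ge>1. \<forall>S\<in>Y. \<forall>T\<in>Y.
    (\<forall>s\<in>ball 0 (K * r). tiling_dist (shift s (g S)) (shift s (g T)) \<le> \<delta>) \<longrightarrow>
    (\<forall>t\<in>ball 0 r. tiling_dist (shift t S) (shift t T) \<le> \<epsilon>)"
proof -
  define e1 where "e1 = min (\<epsilon> / 2) (min (1 / 2) (\<kappa> / 8))"
  have e1: "0 < e1" "2 * e1 \<le> \<epsilon>" "e1 \<le> 1 / 2" "8 * e1 \<le> \<kappa>"
    using \<open>0 < \<epsilon>\<close> \<open>0 < \<kappa>\<close> by (auto simp: e1_def min_def)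
  obtain d1 where d1: "0 < d1" "\<And>S T. S \<in> X \<Longrightarrow> T \<in> X \<Longrightarrow> near d1 S T \<Longrightarrow> near e1 (f S) (f T)"
    using f(1) e1(1) unfolding near_uniformly_continuous_def by blast
  define e2 where "e2 = min (1 / 2) (\<kappa> / 8)"
  have e2: "0 < e2" "e2 \<le> 1 / 2" "4 * e2 < \<kappa>" using \<open>0 < \<kappa>\<close> by (auto simp: e2_def min_def)
  obtain d2 where d2: "0 < d2" "\<And>S T. S \<in> Y \<Longrightarrow> T \<in> Y \<Longrightarrow> near d2 S T \<Longrightarrow> near e2 (g S) (g T)"
    using g(1) e2(1) unfolding near_uniformly_continuous_def by blast
  define K where "K = 2 / d2 + 1"
  have K: "0 < K" using d2(1) by (simp add: K_def add_pos_pos)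
  define e where "e = min d1 (min (1 / 2) (\<kappa> / 4))"
  have e: "0 < e" "e \<le> d1" "e \<le> 1 / 2" "2 * e < \<kappa>" using d1(1) \<open>0 < \<kappa>\<close> by (auto simp: e_def min_def)
  have main: "near (2 * e1) (shift t S) (shift t T)"
    if r: "1 \<le> r" and ST: "S \<in> Y" "T \<in> Y" and t: "t \<in> ball 0 r"
      and near: "\<And>s. s \<in> ball 0 (K * r) \<Longrightarrow> near e (shift s (g S)) (shift s (g T))" for r S T t
  proof -
    define L v where "L = norm t" and "v = sgn t"
    have L: "0 \<le> L" "L < r" using t by (auto simp: L_def)
    have v: "norm v \<le> 1" "L *\<^sub>R v = t"
      by (auto simp: v_def norm_sgn) (cases "t = 0"; simp add: L_def v_def sgn_div_norm)
    have gX: "g S \<in> X" "g T \<in> X" using ST g(2) by auto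
    have "0 < K * r" using K r by simp
    obtain u where u: "norm u \<le> e" "\<And>s. s \<in> ball 0 (K * r) \<Longrightarrow> agree (shift u (g S)) (g T) s (1 / e)"
      using translations_constant[OF X(1)[OF gX(1)] X(1)[OF gX(2)], of e "K * r"] e near \<open>0 < K * r\<close>
      by auto
\<comment> \<open>The segment from \<open>T\<close> to \<open>T - t\<close>, pulled back to \<open>X\<close> and lifted to the translation vectors \<open>\<psi>\<close>.\<close>
    let ?\<gamma> = "\<lambda>s. g (shift (s *\<^sub>R v) T)"
    have \<gamma>path: "tiling_path L ?\<gamma>"
      using tiling_path_image[OF g(1) translation_path[OF v(1)]] Y(2)[OF ST(2)] by simp
    have "\<And>s. s \<in> {0..L} \<Longrightarrow> rigid \<kappa> (?\<gamma> s)"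
      using X(1) g(2) Y(2) ST(2) by blast
    then obtain \<psi> where \<psi>': "is_lift \<kappa> L ?\<gamma> \<psi>"
      using orbit_lift[OF \<gamma>path _ \<open>0 < \<kappa>\<close> L(1)] by blast
    then have \<psi>: "\<psi> 0 = 0" "\<And>s. s \<in> {0..L} \<Longrightarrow> ?\<gamma> s = shift (\<psi> s) (?\<gamma> 0)"
      unfolding is_lift_def by blast+
    have \<psi>2: "f (shift (\<psi> s) (g T)) = shift (s *\<^sub>R v) T" if "s \<in> {0..L}" for s
    proof -
      have "g (shift (s *\<^sub>R v) T) = shift (\<psi> s) (g T)" using \<psi>(2)[OF that] by simp
      then show ?thesis using g(3)[OF Y(2)[OF ST(2)], of "s *\<^sub>R v"] by simp
    qed
    have \<psi>bound: "\<psi> s \<in> ball 0 (K * r)" if "s \<in> {0..L}" for s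
    proof -
      have "near e2 (g (shift (s *\<^sub>R v) T)) (g (shift (t *\<^sub>R v) T))" if st: "\<bar>s - t\<bar> < d2" for s t
      proof -
        have "norm (s *\<^sub>R v - t *\<^sub>R v) = \<bar>s - t\<bar> * norm v" by (simp flip: scaleR_diff_left)
        also have "\<dots> \<le> \<bar>s - t\<bar> * 1" using v by (intro mult_left_mono) auto
        finally show ?thesis
          using st by (intro d2(2) near_orbit Y(2) ST(2)) auto
      qed
      then have step: "norm (\<psi> s - \<psi> t) \<le> e2" if "s \<in> {0..L}" "t \<in> {0..L}" "\<bar>s - t\<bar> < d2" for s t
        using \<psi>' e2 that unfolding is_lift_def by blast
      have "norm (\<psi> s) \<le> (2 * s / d2 + 1) * e2"
        using lift_bound[of \<psi> d2 e2 L s] \<psi>(1) d2(1) e2 step that by simp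
      also have "\<dots> \<le> (2 * s / d2 + 1) * 1" using that d2(1) e2 by (intro mult_left_mono) auto
      also have "\<dots> < 2 * r / d2 + r"
        using that L(2) r d2(1) by (auto intro!: add_less_le_mono divide_strict_right_mono)
      also have "\<dots> = K * r" by (simp add: K_def algebra_simps)
      finally show ?thesis by simp
    qed
    define S' where "S' = shift u (g S)"
    have S': "S' \<in> X" using X(2) gX(1) by (simp add: S'_def)
    have \<psi>path: "tiling_path L (\<lambda>s. shift (\<psi> s) S')"
      unfolding tiling_path_def
    proof (intro allI impI)
      fix c :: real assume "0 < c"
      obtain d where "0 < d" "\<And>s t. \<lbrakk>s \<in> {0..L}; t \<in> {0..L}; \<bar>s - t\<bar> < d\<rbrakk> \<Longrightarrow> norm (\<psi> s - \<psi> t) \<le> c"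
        using lift_continuous[OF \<gamma>path \<open>0 < \<kappa>\<close> \<psi>' \<open>0 < c\<close>] by metis
      then show "\<exists>d>0. \<forall>s\<in>{0..L}. \<forall>t\<in>{0..L}. \<bar>s - t\<bar> < d \<longrightarrow> near c (shift (\<psi> s) S') (shift (\<psi> t) S')"
        using near_orbit by blast
    qed
\<comment> \<open>The same translations applied to \<open>S'\<close>, pushed forward again: this path shadows the segment.\<close>
    let ?\<beta> = "\<lambda>s. f (shift (\<psi> s) S')"
    have \<beta>path: "tiling_path L ?\<beta>"
      using tiling_path_image[OF f(1) \<psi>path] X(2)[OF S'] by simp
    have "\<And>s. s \<in> {0..L} \<Longrightarrow> rigid \<kappa> (?\<beta> s)"
      using Y(1) f(2) X(2) S' by blast
    then obtain \<phi> where \<phi>': "is_lift \<kappa> L ?\<beta> \<phi>"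
      using orbit_lift[OF \<beta>path _ \<open>0 < \<kappa>\<close> L(1)] by blast
    then have \<phi>: "\<phi> 0 = 0" "\<And>s. s \<in> {0..L} \<Longrightarrow> ?\<beta> s = shift (\<phi> s) (?\<beta> 0)"
      unfolding is_lift_def by blast+
    obtain d where d: "0 < d" "\<And>s t. \<lbrakk>s \<in> {0..L}; t \<in> {0..L}; \<bar>s - t\<bar> < d\<rbrakk> \<Longrightarrow> norm (\<phi> s - \<phi> t) \<le> e1"
      using lift_continuous[OF \<beta>path \<open>0 < \<kappa>\<close> \<phi>' e1(1)] by metis
    define S1 where "S1 = f S'"
    have S1: "S1 \<in> Y" "\<And>s. s \<in> {0..L} \<Longrightarrow> f (shift (\<psi> s) S') = shift (\<phi> s) S1"
      using f(2)[OF S'] \<phi>(2) \<psi>(1) by (auto simp: S1_def)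
    have "\<exists>w. norm w \<le> e1 \<and> agree (shift (w + \<phi> s - s *\<^sub>R v) S1) T (s *\<^sub>R v) (1 / e1)"
      if s: "s \<in> {0..L}" for s
    proof -
      have "agree S' (g T) (\<psi> s) (1 / e)" using u(2)[OF \<psi>bound[OF s]] by (simp add: S'_def)
      then have "near e (shift (\<psi> s) S') (shift (\<psi> s) (g T))" using nearI_agree e by blast
      then have "near d1 (shift (\<psi> s) S') (shift (\<psi> s) (g T))" using near_mono e by blast
      then have "near e1 (f (shift (\<psi> s) S')) (f (shift (\<psi> s) (g T)))"
        using d1(2) X(2) S' gX(2) by blast
      then have "near e1 (shift (\<phi> s) S1) (shift (s *\<^sub>R v) T)"
        using S1(2)[OF s] \<psi>2[OF s] by simp
      then obtain w where w: "norm w \<le> e1" "agree (shift w (shift (\<phi> s) S1)) (shift (s *\<^sub>R v) T) 0 (1 / e1)"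
        unfolding near_def by blast
      then have "agree (shift (s *\<^sub>R v) (shift (w + \<phi> s - s *\<^sub>R v) S1)) (shift (s *\<^sub>R v) T) 0 (1 / e1)"
        by simp
      then show ?thesis using w(1) unfolding agree_shift by auto
    qed
    then obtain w where w: "\<And>s. s \<in> {0..L} \<Longrightarrow> norm (w s) \<le> e1"
      "\<And>s. s \<in> {0..L} \<Longrightarrow> agree (shift (w s + \<phi> s - s *\<^sub>R v) S1) T (s *\<^sub>R v) (1 / e1)"
      by metis
\<comment> \<open>The displacement from \<open>S1\<close> to \<open>T\<close> seen at the point \<open>s *\<^sub>R v\<close>.\<close>
    define z where "z s = w s + \<phi> s - s *\<^sub>R v" for s
    have "z L = z 0"
    proof (rule chain_convex[of "{0..L}" 0 L "\<lambda>s. z s = z 0" "min d e1"])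
      fix p q assume pq: "p \<in> {0..L}" "q \<in> {0..L}" "dist p q < min d e1" "z p = z 0"
      have "norm (p *\<^sub>R v - q *\<^sub>R v) = \<bar>p - q\<bar> * norm v" by (simp flip: scaleR_diff_left)
      also have "\<dots> \<le> \<bar>p - q\<bar> * 1" using v by (intro mult_left_mono) auto
      finally have pqv: "norm (p *\<^sub>R v - q *\<^sub>R v) < e1" using pq(3) by (simp add: dist_real_def)
      have split: "z p - z q = w p - w q + (\<phi> p - \<phi> q) - (p *\<^sub>R v - q *\<^sub>R v)" by (simp add: z_def)
      have "norm (\<phi> p - \<phi> q) \<le> e1" using d(2) pq by (simp add: dist_real_def)
      then have "norm (z p - z q) < \<kappa>"
        unfolding split using w(1)[OF pq(1)] w(1)[OF pq(2)] pqv e1 norm_triangle_ineq4[of "w p" "w q"]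
          norm_triangle_ineq[of "w p - w q" "\<phi> p - \<phi> q"]
          norm_triangle_ineq4[of "w p - w q + (\<phi> p - \<phi> q)" "p *\<^sub>R v - q *\<^sub>R v"] by linarith
      moreover have "dist (p *\<^sub>R v) (q *\<^sub>R v) < 1 / e1" "0 < 1 / e1"
      proof -
        have "e1 \<le> 1 / e1" using e1 by (simp add: pos_le_divide_eq mult_le_one)
        then show "dist (p *\<^sub>R v) (q *\<^sub>R v) < 1 / e1" using pqv by (simp add: dist_norm)
        show "0 < 1 / e1" using e1 by simp
      qed
      ultimately have "z p = z q"
        using displacement_unique[OF Y(1)[OF S1(1)] Y(1)[OF ST(2)] w(2)[OF pq(1)] _ w(2)[OF pq(2)], of "q *\<^sub>R v"]
        by (simp add: z_def)
      then show "z q = z 0" using pq(4) by simp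
    qed (use L d e1 in auto)
    moreover have "z 0 = w 0" by (simp add: z_def \<phi>(1))
    ultimately have z: "norm (z L) \<le> e1" using w(1)[of 0] L by simp
    have aT: "agree (shift (z L) S1) T t (1 / e1)"
      using w(2)[of L] L v(2) by (simp add: z_def)
\<comment> \<open>\<open>S1\<close> is the image of \<open>g S\<close> translated by the small vector \<open>u\<close>, so it is a small translate of \<open>S\<close>.\<close>
    have "\<exists>w. norm w \<le> e1 \<and> f (shift (1 *\<^sub>R u) (g S)) = shift w (f (shift (0 *\<^sub>R u) (g S)))"
    proof (rule short_path_in_orbit[where \<kappa> = \<kappa>])
      have "norm u \<le> 1" using u(1) e by simp
      then have "tiling_path 1 (\<lambda>s. f (shift (s *\<^sub>R u) (g S)))"
        using tiling_path_image[OF f(1) translation_path] X(2)[OF gX(1)] by blast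
      then show "\<And>e. 0 < e \<Longrightarrow> \<exists>d>0. \<forall>s\<in>{0..1}. \<forall>t\<in>{0..1}. \<bar>s - t\<bar> < d \<longrightarrow>
          near e (f (shift (s *\<^sub>R u) (g S))) (f (shift (t *\<^sub>R u) (g S)))"
        unfolding tiling_path_def by blast
      show "\<And>s. s \<in> {0..1} \<Longrightarrow> rigid \<kappa> (f (shift (s *\<^sub>R u) (g S)))"
        using Y(1) f(2) X(2) gX(1) by blast
      show "near e1 (f (shift (0 *\<^sub>R u) (g S))) (f (shift (s *\<^sub>R u) (g S)))" if "s \<in> {0..1}" for s
      proof (rule d1(2)[OF X(2)[OF gX(1)] X(2)[OF gX(1)]], rule near_orbit)
        have "s * norm u \<le> 1 * e" using that u(1) by (intro mult_mono) auto
        then show "norm (0 *\<^sub>R u - s *\<^sub>R u) \<le> d1" using that e(2) by simp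
      qed
    qed (use e1 in auto)
    then obtain x where x: "norm x \<le> e1" "S1 = shift x S"
      using g(3)[OF ST(1)] by (auto simp: S1_def S'_def)
    have "agree (shift t (shift (z L + x) S)) (shift t T) 0 (1 / e1)"
      unfolding agree_shift using aT x(2) by simp
    then have "agree (shift (z L + x) (shift t S)) (shift t T) 0 (1 / e1)"
      by (simp add: algebra_simps)
    moreover have "norm (z L + x) \<le> 2 * e1" using z x(1) norm_triangle_ineq[of "z L" x] by linarith
    moreover have "1 / (2 * e1) \<le> 1 / e1" using e1 by (simp add: frac_le)
    ultimately show ?thesis
      unfolding near_def using agree_mono[of _ _ 0 "1 / e1" 0 "1 / (2 * e1)"] by fastforce
  qed
  have "\<forall>r\<ge>1. \<forall>S\<in>Y. \<forall>T\<in>Y.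
    (\<forall>s\<in>ball 0 (K * r). tiling_dist (shift s (g S)) (shift s (g T)) \<le> e / 4) \<longrightarrow>
    (\<forall>t\<in>ball 0 r. tiling_dist (shift t S) (shift t T) \<le> \<epsilon>)"
  proof (intro allI ballI impI)
    fix r S T and t :: 'a
    assume r: "1 \<le> r" and ST: "S \<in> Y" "T \<in> Y" and t: "t \<in> ball 0 r"
      and close: "\<forall>s\<in>ball 0 (K * r). tiling_dist (shift s (g S)) (shift s (g T)) \<le> e / 4"
    have "near e (shift s (g S)) (shift s (g T))" if "s \<in> ball 0 (K * r)" for s
      using tiling_dist_near[of "shift s (g S)" "shift s (g T)" "e / 2"] bspec[OF close that] e by simp
    then have "near (2 * e1) (shift t S) (shift t T)" using main[OF r ST t] by blast
    then have "tiling_dist (shift t S) (shift t T) \<le> 2 * e1" using near_tiling_dist[of "2 * e1"] e1(1) by simp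
    then show "tiling_dist (shift t S) (shift t T) \<le> \<epsilon>" using e1(2) by simp
  qed
  with K have K': "\<exists>K>0. \<forall>r\<ge>1. \<forall>S\<in>Y. \<forall>T\<in>Y.
    (\<forall>s\<in>ball 0 (K * r). tiling_dist (shift s (g S)) (shift s (g T)) \<le> e / 4) \<longrightarrow>
    (\<forall>t\<in>ball 0 r. tiling_dist (shift t S) (shift t T) \<le> \<epsilon>)"
    by (intro exI[of _ K] conjI)
  have e4: "0 < e / 4" using e(1) by simp
  show ?thesis by (rule exI[of _ "e / 4"], rule conjI, rule e4, rule K')
qed

section \<open>Compactness of the hull\<close>

lemma is_tiling_shift:
  assumes "is_tiling \<P> T" shows "is_tiling \<P> (shift x T)"
proof -
  have img: "fst (tile_shift x t) = (\<lambda>y. - x + y) ` fst t" for t :: "('a, 'b) tile"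
    by (simp add: tile_shift_def)
  have tile: "is_tile (tile_shift x t)" if "is_tile t" for t :: "('a, 'b) tile"
  proof -
    have c: "compact (fst t)" and h: "fst t homeomorphic cball (0::'a) 1" and i: "closure (interior (fst t)) = fst t"
      using that by (simp_all add: is_tile_def)
    have "(\<lambda>y. - x + y) ` fst t homeomorphic fst t"
      by (rule homeomorphic_sym[THEN iffD1, OF homeomorphic_translation])
    then have "(\<lambda>y. - x + y) ` fst t homeomorphic cball (0::'a) 1"
      using h by (rule homeomorphic_trans)
    moreover have "closure (interior ((\<lambda>y. - x + y) ` fst t)) = (\<lambda>y. - x + y) ` fst t"
      by (simp only: interior_translation closure_translation i)
    moreover have "compact ((\<lambda>y. - x + y) ` fst t)" using c by (rule compact_translation)
    ultimately show ?thesis unfolding is_tile_def img by blast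
  qed
  have cls: "tile_class (tile_shift x t) = tile_class t" for t :: "('a, 'b) tile"
    unfolding tile_class_def
  proof (intro set_eqI iffI)
    fix s assume "s \<in> range (\<lambda>y. tile_shift y (tile_shift x t))"
    then obtain y where "s = tile_shift (y + x) t" by auto
    then show "s \<in> range (\<lambda>y. tile_shift y t)" by (rule range_eqI)
  next
    fix s assume "s \<in> range (\<lambda>y. tile_shift y t)"
    then obtain y where "s = tile_shift y t" by (rule rangeE)
    then have "s = tile_shift (y - x) (tile_shift x t)" by simp
    then show "s \<in> range (\<lambda>y. tile_shift y (tile_shift x t))" by (rule range_eqI)
  qed
  have cov: "(\<Union>t\<in>shift x T. fst t) = UNIV"
  proof -
    have "y + x \<in> (\<Union>t\<in>T. fst t)" for y
      using assms by (simp add: is_tiling_def)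
    then have "\<exists>t\<in>T. y + x \<in> fst t" for y by simp
    then show ?thesis by (auto simp: shift_def fst_tile_shift)
  qed
  have "interior (fst (tile_shift x s) \<inter> fst (tile_shift x t)) = {}"
    if "s \<in> T" "t \<in> T" "tile_shift x s \<noteq> tile_shift x t" for s t
  proof -
    have "fst (tile_shift x s) \<inter> fst (tile_shift x t) = (\<lambda>y. - x + y) ` (fst s \<inter> fst t)"
      unfolding img by (rule image_Int[symmetric]) simp
    moreover have "s \<noteq> t" using that(3) by auto
    then have "interior (fst s \<inter> fst t) = {}"
      using assms that(1,2) by (simp add: is_tiling_def)
    ultimately show ?thesis by (simp only: interior_translation image_empty)
  qed
  then have "\<forall>s\<in>shift x T. \<forall>t\<in>shift x T. s \<noteq> t \<longrightarrow> interior (fst s \<inter> fst t) = {}"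
    unfolding shift_def ball_simps by blast
  moreover have "\<forall>t\<in>shift x T. is_tile t \<and> tile_class t \<in> \<P>"
    using assms tile cls by (simp add: is_tiling_def shift_def)
  ultimately show ?thesis
    using cov unfolding is_tiling_def by (intro conjI)
qed

text \<open>The small translation in the definition of the distance can be absorbed into the translation of
  \<open>T0\<close>, so membership in the closure becomes exact agreement of patches.\<close>

lemma mem_tiling_hull_iff:
  assumes "prototile_set \<P>" "is_tiling \<P> T0"
  shows "S \<in> tiling_hull \<P> T0 \<longleftrightarrow>
    is_tiling \<P> S \<and> (\<forall>R>0. \<exists>x. agree S (shift x T0) 0 R)"
proof -
  interpret M: Metric_space "{T. is_tiling \<P> T}" tiling_dist
    by (rule Metric_space_tilings) fact
  have "S \<in> tiling_hull \<P> T0 \<longleftrightarrow>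
    is_tiling \<P> S \<and> (\<forall>e>0. \<exists>x. tiling_dist S (shift x T0) < e)"
    unfolding tiling_hull_def tiling_topology_def M.metric_closure_of
    using is_tiling_shift[OF assms(2)] by auto
  moreover have "\<exists>x. agree S (shift x T0) 0 R"
    if "0 < R" and close: "\<And>e. 0 < e \<Longrightarrow> \<exists>x. tiling_dist S (shift x T0) < e" for R
  proof -
    define e where "e = min (1 / 2) (1 / (2 * (R + 1)))"
    have e: "0 < e" "e \<le> 1 / 2" "R + 1 \<le> 1 / (2 * e)"
      using \<open>0 < R\<close> by (auto simp: e_def min_def field_simps)
    obtain x where "tiling_dist S (shift x T0) < e" using close e(1) by blast
    then have "near (2 * e) S (shift x T0)" using tiling_dist_near e(2) by blast
    then obtain w where w: "norm w \<le> 2 * e" "agree (shift w S) (shift x T0) 0 (1 / (2 * e))"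
      by (auto simp: near_def)
    have "agree (shift (- w) (shift w S)) (shift (- w) (shift x T0)) w (1 / (2 * e))"
      unfolding agree_shift using w(2) by simp
    then have "agree S (shift (x - w) T0) w (1 / (2 * e))" by (simp add: algebra_simps)
    then have "agree S (shift (x - w) T0) 0 R"
      by (rule agree_mono) (use w(1) e in auto)
    then show ?thesis by blast
  qed
  moreover have "\<exists>x. tiling_dist S (shift x T0) < e"
    if "0 < e" and close: "\<And>R. 0 < R \<Longrightarrow> \<exists>x. agree S (shift x T0) 0 R" for e
  proof -
    obtain x where "agree S (shift x T0) 0 (1 / (e / 2))" using close[of "1 / (e / 2)"] \<open>0 < e\<close> by auto
    then have "near (e / 2) S (shift x T0)"
      using nearI_agree[of S "shift x T0" 0 "e / 2"] \<open>0 < e\<close> by simp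
    then have "tiling_dist S (shift x T0) \<le> e / 2" using near_tiling_dist[of "e / 2"] \<open>0 < e\<close> by simp
    then show ?thesis using \<open>0 < e\<close> by (intro exI[of _ x]) simp
  qed
  ultimately show ?thesis by blast
qed

lemma tiling_hull_shift:
  assumes "prototile_set \<P>" "is_tiling \<P> T0" "S \<in> tiling_hull \<P> T0"
  shows "shift x S \<in> tiling_hull \<P> T0"
  unfolding mem_tiling_hull_iff[OF assms(1,2)]
proof (intro conjI allI impI)
  show "is_tiling \<P> (shift x S)"
    using assms is_tiling_shift mem_tiling_hull_iff by blast
  fix R :: real assume "0 < R"
  then have "0 < R + norm x" by (simp add: add_pos_nonneg)
  then obtain y where "agree S (shift y T0) 0 (R + norm x)"
    using assms mem_tiling_hull_iff by blast
  then have "agree S (shift y T0) (0 + x) R" by (rule agree_mono) simp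
  then have "agree (shift x S) (shift (x + y) T0) 0 R"
    unfolding shift_shift[symmetric] agree_shift .
  then show "\<exists>y. agree (shift x S) (shift y T0) 0 R" by blast
qed

lemma finite_separated_bounded:
  fixes A :: "'a::heine_borel set"
  assumes "bounded A" "0 < \<kappa>" "\<And>x y. x \<in> A \<Longrightarrow> y \<in> A \<Longrightarrow> dist x y < \<kappa> \<Longrightarrow> x = y"
  shows "finite A"
proof (rule ccontr)
  assume "infinite A"
  then obtain x where x: "x islimpt A" using bounded_infinite_imp_islimpt[OF subset_refl assms(1)] by blast
  obtain a where a: "a \<in> A" "a \<noteq> x" "dist a x < \<kappa> / 2"
    using x \<open>0 < \<kappa>\<close> unfolding islimpt_approachable by (metis half_gt_zero)
  then have "0 < min (dist a x) (\<kappa> / 2)" using \<open>0 < \<kappa>\<close> by simp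
  then obtain b where b: "b \<in> A" "b \<noteq> x" "dist b x < min (dist a x) (\<kappa> / 2)"
    using x unfolding islimpt_approachable by metis
  have "dist a b < \<kappa>" using a(3) b(3) dist_triangle2[of a b x] by simp
  then have "a = b" using assms(3) a b by blast
  then show False using b by simp
qed

text \<open>Finite local complexity bounds the number of patches up to translation. Fixing a tile
  \<open>t0\<close> in the patch restricts the translations of a representative to those moving one of its tiles
  to \<open>t0\<close>; they form a bounded set, and a separated one by rigidity.\<close>

lemma finite_anchored_patches:
  fixes T0 :: "('a::euclidean_space, 'l) tiling"
  assumes "prototile_set \<P>" "is_tiling \<P> T0" "FLC T0" "is_tile t0" "0 \<in> fst t0" "0 < R"
  shows "finite {patch S 0 R | S. S \<in> tiling_hull \<P> T0 \<and> t0 \<in> S}"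
proof -
  obtain \<kappa> where \<kappa>: "0 < \<kappa>" "\<And>T. is_tiling \<P> T \<Longrightarrow> rigid \<kappa> T"
    using rigid_prototiles[OF assms(1)] by blast
  have rig: "rigid \<kappa> T0" using \<kappa>(2) assms(2) by blast
  obtain B where B: "\<And>y. y \<in> fst t0 \<Longrightarrow> norm y \<le> B"
    using assms(4) compact_imp_bounded[of "fst t0"] unfolding is_tile_def bounded_iff by blast
  let ?F = "{range (\<lambda>y. shift y (patch T0 x R)) | x. True}"
  have finF: "finite ?F" using assms(3,6) unfolding FLC_def by blast
  have one_class: "finite {Q \<in> C. t0 \<in> Q}" if "C \<in> ?F" for C
  proof -
    have "\<exists>x. C = range (\<lambda>y. shift y (patch T0 x R))" using that by simp
    then obtain x where C: "C = range (\<lambda>y. shift y (patch T0 x R))" ..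
    define A where "A = {y. tile_shift (- y) t0 \<in> patch T0 x R}"
    have "bounded A"
      unfolding bounded_iff
    proof (intro exI[of _ "B + norm x + R"] ballI)
      fix y assume "y \<in> A"
      then obtain z where z: "z \<in> fst (tile_shift (- y) t0)" "dist x z < R"
        unfolding A_def patch_def by (auto simp: disjoint_iff)
      have "norm (z - y) \<le> B" using z(1) by (intro B) (simp add: fst_tile_shift)
      moreover have "norm y \<le> norm z + norm (z - y)" using norm_triangle_ineq4[of z "z - y"] by simp
      moreover have "norm z \<le> norm x + dist x z" using norm_triangle_ineq4[of x "x - z"] by (simp add: dist_norm)
      ultimately show "norm y \<le> B + norm x + R" using z(2) by linarith
    qed
    moreover have "y = z" if "y \<in> A" "z \<in> A" "dist y z < \<kappa>" for y z
    proof -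
      have "tile_shift (- y) t0 \<in> T0" "tile_shift (y - z) (tile_shift (- y) t0) \<in> T0" "norm (y - z) < \<kappa>"
        using that by (auto simp: A_def patch_def dist_norm)
      then have "y - z = 0" using rig unfolding rigid_def by blast
      then show ?thesis by simp
    qed
    ultimately have "finite A" using finite_separated_bounded \<kappa>(1) by blast
    moreover have "{Q \<in> C. t0 \<in> Q} \<subseteq> (\<lambda>y. shift y (patch T0 x R)) ` A"
      by (auto simp: C A_def mem_shift_iff)
    ultimately show ?thesis using finite_surj by blast
  qed
  have "{patch S 0 R | S. S \<in> tiling_hull \<P> T0 \<and> t0 \<in> S} \<subseteq> (\<Union>C\<in>?F. {Q \<in> C. t0 \<in> Q})"
  proof clarify
    fix S assume S: "S \<in> tiling_hull \<P> T0" "t0 \<in> S"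
    obtain x where x: "agree S (shift x T0) 0 R"
      using S(1) \<open>0 < R\<close> mem_tiling_hull_iff[OF assms(1,2)] by blast
    have "patch S 0 R = shift x (patch T0 x R)"
      using x unfolding agree_def patch_shift by simp
    moreover have "t0 \<in> patch S 0 R" using S(2) assms(5,6) by (auto simp: patch_def)
    ultimately have "patch S 0 R \<in> {Q \<in> range (\<lambda>y. shift y (patch T0 x R)). t0 \<in> Q}" by simp
    moreover have "range (\<lambda>y. shift y (patch T0 x R)) \<in> ?F" by auto
    ultimately show "patch S 0 R \<in> (\<Union>C\<in>?F. {Q \<in> C. t0 \<in> Q})" by (rule UN_I[rotated])
  qed
  moreover have "finite (\<Union>C\<in>?F. {Q \<in> C. t0 \<in> Q})" using finF one_class by (rule finite_UN_I)
  ultimately show ?thesis by (rule finite_subset)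
qed

text \<open>The limit consists of the tiles that eventually belong to all \<open>U n\<close>.\<close>

lemma hull_limit:
  assumes "prototile_set \<P>" "is_tiling \<P> T0" and U: "\<And>n. U n \<in> tiling_hull \<P> T0"
    and agr: "\<And>k m n. k \<le> m \<Longrightarrow> k \<le> n \<Longrightarrow> agree (U m) (U n) 0 (real (Suc k))"
  obtains l where "l \<in> tiling_hull \<P> T0" "\<And>n. agree (U n) l 0 (real (Suc n))"
proof -
  define l where "l = {t. \<exists>k. \<forall>n\<ge>k. t \<in> U n}"
  have l: "agree (U n) l 0 (real (Suc n))" for n
    unfolding agree_iff
  proof (intro allI impI)
    fix t :: "('a, 'b) tile" and y :: 'a assume y: "y \<in> fst t" "dist 0 y < real (Suc n)"
    have eq: "t \<in> U n \<longleftrightarrow> t \<in> U m" if "n \<le> m" for m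
      using agreeD[OF agr[OF order_refl that] y] .
    show "t \<in> U n \<longleftrightarrow> t \<in> l"
    proof
      assume "t \<in> U n" then show "t \<in> l" unfolding l_def using eq by blast
    next
      assume "t \<in> l"
      then obtain k where "\<forall>n\<ge>k. t \<in> U n" unfolding l_def by blast
      then have "t \<in> U (max k n)" by simp
      then show "t \<in> U n" using eq[of "max k n"] by simp
    qed
  qed
  have til: "is_tiling \<P> (U n)" for n
    using U mem_tiling_hull_iff[OF assms(1,2)] by blast
  have "is_tiling \<P> l"
    unfolding is_tiling_def
  proof (intro conjI ballI impI)
    fix t assume "t \<in> l"
    then obtain n where "t \<in> U n" unfolding l_def by blast
    then show "is_tile t" "tile_class t \<in> \<P>" using til[of n] by (simp_all add: is_tiling_def)
  next
    have "x \<in> (\<Union>t\<in>l. fst t)" for x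
    proof -
      define n where "n = nat \<lceil>norm x\<rceil>"
      have n: "dist 0 x < real (Suc n)" unfolding n_def dist_norm by (simp add: algebra_simps) linarith
      have "x \<in> (\<Union>t\<in>U n. fst t)" using til[of n] by (simp add: is_tiling_def)
      then obtain t where t: "t \<in> U n" "x \<in> fst t" by (rule UN_E)
      then have "t \<in> l" using agreeD[OF l t(2) n] by blast
      then show ?thesis using t(2) by (rule UN_I)
    qed
    then show "(\<Union>t\<in>l. fst t) = UNIV" by (rule UNIV_eq_I[symmetric])
  next
    fix s t assume "s \<in> l" "t \<in> l" "s \<noteq> t"
    then obtain j k where "\<forall>n\<ge>j. s \<in> U n" "\<forall>n\<ge>k. t \<in> U n" unfolding l_def by blast
    then have "s \<in> U (max j k)" "t \<in> U (max j k)" by simp_all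
    then show "interior (fst s \<inter> fst t) = {}"
      using til[of "max j k"] \<open>s \<noteq> t\<close> by (simp add: is_tiling_def)
  qed
  moreover have "\<exists>x. agree l (shift x T0) 0 R" if "0 < R" for R
  proof -
    define n where "n = nat \<lceil>R\<rceil>"
    have n: "R \<le> real (Suc n)" unfolding n_def by linarith
    obtain x where x: "agree (U n) (shift x T0) 0 R"
      using U[of n] \<open>0 < R\<close> mem_tiling_hull_iff[OF assms(1,2)] by blast
    have "agree l (U n) 0 R"
      using agree_sym[OF agree_mono[OF l[of n], of 0 R]] n by simp
    then show ?thesis using x agree_trans by blast
  qed
  ultimately have "l \<in> tiling_hull \<P> T0"
    unfolding mem_tiling_hull_iff[OF assms(1,2)] by blast
  then show thesis using l by (rule that)
qed

lemma subseq_constant: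
  assumes "finite (range f)"
  obtains r :: "nat \<Rightarrow> nat" and n0 where "strict_mono r" "\<And>n. f (r n) = f n0"
proof -
  obtain n0 where "infinite {n \<in> UNIV. f n = f n0}"
    using pigeonhole_infinite[OF infinite_UNIV_nat assms] by blast
  then obtain r :: "nat \<Rightarrow> nat" where r: "strict_mono r" "\<forall>n. r n \<in> {n \<in> UNIV. f n = f n0}"
    using infinite_enumerate by blast
  then show thesis by (intro that[of r n0]) auto
qed

text \<open>After passing to a subsequence the tiles at the origin are translates of one tile \<open>q\<close> by convergent
  vectors. A small correction of each tiling makes this tile the same tile \<open>t0\<close> throughout. Then
  only finitely many patches occur at each radius, and a diagonal subsequence stabilises all of
  them.\<close>

lemma hull_seq_compact:
  fixes T0 :: "('a::euclidean_space, 'l) tiling" and S :: "nat \<Rightarrow> ('a, 'l) tiling"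
  assumes "prototile_set \<P>" "is_tiling \<P> T0" "FLC T0" and S: "\<And>n. S n \<in> tiling_hull \<P> T0"
  obtains r l where "strict_mono r" "l \<in> tiling_hull \<P> T0"
    "\<And>e. 0 < e \<Longrightarrow> \<forall>\<^sub>F n in sequentially. near e (S (r n)) l"
proof -
  note hull = mem_tiling_hull_iff[OF assms(1,2)]
  have til: "is_tiling \<P> (S n)" for n
    using S hull by blast
  have "\<exists>t\<in>S n. 0 \<in> fst t" for n
  proof -
    have "0 \<in> (\<Union>t\<in>S n. fst t)" using til[of n] by (simp add: is_tiling_def)
    then show ?thesis by blast
  qed
  then obtain t where t: "\<And>n. t n \<in> S n" "\<And>n. 0 \<in> fst (t n)" by metis
  have tile: "is_tile (t n)" "tile_class (t n) \<in> \<P>" for n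
    using til[of n] t(1)[of n] by (simp_all add: is_tiling_def)
  have "finite (range (\<lambda>n. tile_class (t n)))"
    using tile(2) assms(1) unfolding prototile_set_def by (meson finite_subset image_subsetI)
  then obtain r1 :: "nat \<Rightarrow> nat" and n0 where r1: "strict_mono r1" "\<And>n. tile_class (t (r1 n)) = tile_class (t n0)"
    by (rule subseq_constant) blast
  define q where "q = t n0"
  have "\<exists>y. t (r1 n) = tile_shift y q" for n
  proof -
    have "t (r1 n) \<in> tile_class (t (r1 n))"
      unfolding tile_class_def by (rule range_eqI[of _ _ 0]) simp
    then show ?thesis unfolding r1(2) by (auto simp: tile_class_def q_def)
  qed
  then obtain y where y: "\<And>n. t (r1 n) = tile_shift (y n) q" by metis
  have "y n \<in> fst q" for n
    using t(2)[of "r1 n"] unfolding y by (simp add: fst_tile_shift)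
  moreover have "compact (fst q)" using tile(1) by (simp add: q_def is_tile_def)
  ultimately obtain z r2 where z: "z \<in> fst q" "strict_mono r2" "(y \<circ> r2) \<longlonglongrightarrow> z"
    unfolding compact_def by blast
  define t0 where "t0 = tile_shift z q"
  define V where "V n = shift (z - y (r2 n)) (S (r1 (r2 n)))" for n
  have V: "V n \<in> tiling_hull \<P> T0" for n
    unfolding V_def by (rule tiling_hull_shift[OF assms(1,2) S])
  have t0V: "t0 \<in> V n" for n
  proof -
    have "tile_shift (z - y (r2 n)) (t (r1 (r2 n))) \<in> V n"
      unfolding V_def shift_def using t(1) by blast
    then show ?thesis unfolding y t0_def by simp
  qed
  have t0: "is_tile t0" "0 \<in> fst t0"
  proof -
    have "is_tiling \<P> (V 0)" using V hull by blast
    then show "is_tile t0" using t0V[of 0] by (simp add: is_tiling_def)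
    show "0 \<in> fst t0" using z(1) by (simp add: t0_def fst_tile_shift)
  qed
  interpret subseqs "\<lambda>k s. \<exists>Q. \<forall>n. patch (V (s n)) 0 (real (Suc k)) = Q"
  proof
    fix k :: nat and s :: "nat \<Rightarrow> nat"
    have "range (\<lambda>n. patch (V (s n)) 0 (real (Suc k))) \<subseteq>
        {patch S 0 (real (Suc k)) | S. S \<in> tiling_hull \<P> T0 \<and> t0 \<in> S}"
      using V t0V by blast
    then have "finite (range (\<lambda>n. patch (V (s n)) 0 (real (Suc k))))"
      using finite_anchored_patches[OF assms(1-3) t0, of "real (Suc k)"]
      by (rule finite_subset) simp
    then obtain r :: "nat \<Rightarrow> nat" and n0 where r: "strict_mono r"
        "\<And>n. patch (V (s (r n))) 0 (real (Suc k)) = patch (V (s n0)) 0 (real (Suc k))"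
      by (rule subseq_constant) blast
    have "\<exists>Q. \<forall>n :: nat. patch (V ((s \<circ> r) n)) 0 (real (Suc k)) = Q"
      unfolding comp_apply r(2) by blast
    with r(1) show "\<exists>r :: nat \<Rightarrow> nat. strict_mono r \<and> (\<exists>Q. \<forall>n. patch (V ((s \<circ> r) n)) 0 (real (Suc k)) = Q)" by blast
  qed
  define U where "U n = V (diagseq (Suc n))" for n
  have U: "U n \<in> tiling_hull \<P> T0" for n by (simp only: U_def V)
  have agr: "agree (U m) (U n) 0 (real (Suc k))" if "k \<le> m" "k \<le> n" for k m n
  proof -
    have "\<exists>Q. \<forall>n. patch (V ((diagseq \<circ> (+) (Suc k)) n)) 0 (real (Suc k)) = Q"
      by (rule diagseq_holds) (metis comp_apply)
    then obtain Q where Q: "\<And>n. patch (V (diagseq (Suc k + n))) 0 (real (Suc k)) = Q" by auto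
    show ?thesis
      using Q[of "m - k"] Q[of "n - k"] that by (simp add: agree_def U_def)
  qed
  obtain l where l: "l \<in> tiling_hull \<P> T0" "\<And>n. agree (U n) l 0 (real (Suc n))"
    by (rule hull_limit[OF assms(1,2), of U, OF U agr]) (assumption | rule that)+
  define \<rho> where "\<rho> n = diagseq (Suc n)" for n
  have \<rho>: "strict_mono \<rho>"
    using subseq_diagseq unfolding \<rho>_def strict_mono_def by simp
  show thesis
  proof (rule that)
    show "strict_mono (r1 \<circ> r2 \<circ> \<rho>)" using r1(1) z(2) \<rho> by (intro strict_mono_o)
    show "l \<in> tiling_hull \<P> T0" by fact
    fix e :: real assume "0 < e"
    have "(\<lambda>n. (y \<circ> r2) (\<rho> n)) \<longlonglongrightarrow> z"
      using LIMSEQ_subseq_LIMSEQ[OF z(3) \<rho>] by (simp add: comp_def)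
    then have "\<forall>\<^sub>F n in sequentially. dist ((y \<circ> r2) (\<rho> n)) z < e"
      using \<open>0 < e\<close> by (rule tendstoD)
    moreover have "\<forall>\<^sub>F n in sequentially. 1 / e \<le> real n"
      by (rule eventually_sequentiallyI[of "nat \<lceil>1 / e\<rceil>"]) linarith
    ultimately show "\<forall>\<^sub>F n in sequentially. near e (S ((r1 \<circ> r2 \<circ> \<rho>) n)) l"
    proof eventually_elim
      case (elim n)
      have "agree (shift (z - y (r2 (\<rho> n))) (S (r1 (r2 (\<rho> n))))) l 0 (1 / e)"
        using agree_mono[OF l(2)[of n], of 0 "1 / e"] elim(2) by (simp add: U_def V_def \<rho>_def)
      then show ?case
        unfolding near_def using elim(1) by (intro exI[of _ "z - y (r2 (\<rho> n))"]) (simp add: dist_norm norm_minus_commute)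
    qed
  qed
qed

text \<open>The classical sequence argument: two sequences witnessing failure of uniform continuity have a
  common limit along a subsequence, where continuity gives a contradiction.\<close>

lemma hull_uniformly_continuous:
  fixes T0 :: "('a::euclidean_space, 'l) tiling" and T0' :: "('a, 'm) tiling"
  assumes P: "prototile_set \<P>" "is_tiling \<P> T0" "FLC T0" and P': "prototile_set \<P>'" "is_tiling \<P>' T0'"
    and f: "continuous_map (subtopology (tiling_topology \<P>) (tiling_hull \<P> T0))
      (subtopology (tiling_topology \<P>') (tiling_hull \<P>' T0')) f"
  shows "near_uniformly_continuous (tiling_hull \<P> T0) f"
  unfolding near_uniformly_continuous_def
proof (intro allI impI, rule ccontr)
  fix e :: real assume "0 < e"
  assume neg: "\<not> (\<exists>d>0. \<forall>S\<in>tiling_hull \<P> T0. \<forall>T\<in>tiling_hull \<P> T0. near d S T \<longrightarrow> near e (f S) (f T))"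
  interpret M: Metric_space "{T. is_tiling \<P> T}" tiling_dist
    by (rule Metric_space_tilings) fact
  interpret M': Metric_space "{T. is_tiling \<P>' T}" tiling_dist
    by (rule Metric_space_tilings) fact
  have "\<exists>S T. S \<in> tiling_hull \<P> T0 \<and> T \<in> tiling_hull \<P> T0 \<and> near (1 / real (Suc n)) S T \<and> \<not> near e (f S) (f T)" for n
  proof -
    have "0 < 1 / real (Suc n)" by simp
    then show ?thesis using neg by blast
  qed
  then obtain S T where ST: "\<And>n. S n \<in> tiling_hull \<P> T0" "\<And>n. T n \<in> tiling_hull \<P> T0"
    "\<And>n. near (1 / real (Suc n)) (S n) (T n)" "\<And>n. \<not> near e (f (S n)) (f (T n))"
    by metis
  obtain r l where r: "strict_mono r" and l: "l \<in> tiling_hull \<P> T0"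
    and lim: "\<And>e. 0 < e \<Longrightarrow> \<forall>\<^sub>F n in sequentially. near e (S (r n)) l"
    by (rule hull_seq_compact[OF P, of S, OF ST(1)]) blast
  have til: "is_tiling \<P> X" if "X \<in> tiling_hull \<P> T0" for X
    using that mem_tiling_hull_iff[OF P(1,2)] by blast
  have "limitin M.mtopology (\<lambda>n. S (r n)) l sequentially"
    unfolding M.limitin_metric
  proof (intro conjI allI impI)
    fix c :: real assume "0 < c"
    then have "\<forall>\<^sub>F n in sequentially. near (c / 2) (S (r n)) l" using lim by simp
    then show "\<forall>\<^sub>F n in sequentially. S (r n) \<in> {T. is_tiling \<P> T} \<and> tiling_dist (S (r n)) l < c"
    proof eventually_elim
      case (elim n)
      then have "tiling_dist (S (r n)) l \<le> c / 2" using near_tiling_dist \<open>0 < c\<close> half_gt_zero by blast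
      then show ?case using til ST(1) \<open>0 < c\<close> by simp
    qed
  qed (use til l in simp)
  moreover have "limitin M.mtopology (\<lambda>n. T (r n)) l sequentially"
    unfolding M.limitin_metric
  proof (intro conjI allI impI)
    fix c :: real assume "0 < c"
    then have "\<forall>\<^sub>F n in sequentially. near (c / 4) (S (r n)) l" using lim by simp
    moreover have "\<forall>\<^sub>F n in sequentially. 4 / c \<le> real n"
      by (rule eventually_sequentiallyI[of "nat \<lceil>4 / c\<rceil>"]) linarith
    ultimately show "\<forall>\<^sub>F n in sequentially. T (r n) \<in> {T. is_tiling \<P> T} \<and> tiling_dist (T (r n)) l < c"
    proof eventually_elim
      case (elim n)
      have 1: "tiling_dist (S (r n)) l \<le> c / 4" using elim(1) \<open>0 < c\<close> by (intro near_tiling_dist) auto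
      have "n \<le> r n" using r by (rule seq_suble)
      then have "4 / c \<le> real (Suc (r n))" using elim(2) by simp
      then have "1 / real (Suc (r n)) \<le> c / 4" using \<open>0 < c\<close> by (simp add: field_simps)
      moreover have "tiling_dist (S (r n)) (T (r n)) \<le> 1 / real (Suc (r n))"
        using ST(3) by (intro near_tiling_dist) auto
      moreover have "tiling_dist (T (r n)) l \<le> tiling_dist (S (r n)) (T (r n)) + tiling_dist (S (r n)) l"
        using tiling_dist_triangle[of "T (r n)" l "S (r n)"] by (simp add: tiling_dist_commute)
      ultimately show ?case using til ST(2) 1 \<open>0 < c\<close> by simp
    qed
  qed (use til l in simp)
  ultimately have "limitin (subtopology M.mtopology (tiling_hull \<P> T0)) (\<lambda>n. S (r n)) l sequentially"
    "limitin (subtopology M.mtopology (tiling_hull \<P> T0)) (\<lambda>n. T (r n)) l sequentially"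
    using l ST(1,2) by (simp_all add: limitin_subtopology)
  then have "limitin (subtopology M'.mtopology (tiling_hull \<P>' T0')) (f \<circ> (\<lambda>n. S (r n))) (f l) sequentially"
    "limitin (subtopology M'.mtopology (tiling_hull \<P>' T0')) (f \<circ> (\<lambda>n. T (r n))) (f l) sequentially"
    using f unfolding tiling_topology_def by (blast intro: continuous_map_limit)+
  then have lims: "limitin M'.mtopology (f \<circ> (\<lambda>n. S (r n))) (f l) sequentially"
    "limitin M'.mtopology (f \<circ> (\<lambda>n. T (r n))) (f l) sequentially"
    by (simp_all add: limitin_subtopology)
  define c where "c = min (1 / 2) (e / 2)"
  have c: "0 < c" "c \<le> 1 / 2" "2 * c \<le> e" using \<open>0 < e\<close> by (auto simp: c_def)
  have "\<forall>\<^sub>F n in sequentially. tiling_dist (f (S (r n))) (f l) < c / 2"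
    "\<forall>\<^sub>F n in sequentially. tiling_dist (f (T (r n))) (f l) < c / 2"
    using lims half_gt_zero[OF c(1)] unfolding M'.limitin_metric comp_def
    by (fastforce elim: eventually_mono)+
  then have "\<forall>\<^sub>F n in sequentially. False"
  proof eventually_elim
    case (elim n)
    then have "tiling_dist (f (S (r n))) (f (T (r n))) < c"
      using tiling_dist_triangle[of "f (S (r n))" "f (T (r n))" "f l"] by (simp add: tiling_dist_commute)
    then have "near (2 * c) (f (S (r n))) (f (T (r n)))" using tiling_dist_near c(2) by blast
    then have "near e (f (S (r n))) (f (T (r n)))" by (rule near_mono) (use c in auto)
    then show False using ST(4) by blast
  qed
  then show False by simp
qed

section \<open>Positivity of the entropy\<close>

lemma log_separation_number_transfer:
  assumes g: "g ` Y \<subseteq> X" "inj_on g Y"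
    and close: "\<And>S T t. \<lbrakk>S \<in> Y; T \<in> Y; t \<in> ball 0 r;
        \<And>s. s \<in> ball 0 r' \<Longrightarrow> d (\<alpha> s (g S)) (\<alpha> s (g T)) \<le> \<delta>\<rbrakk>
      \<Longrightarrow> d' (\<alpha>' t S) (\<alpha>' t T) \<le> \<epsilon>"
  shows "log_separation_number Y d' \<alpha>' r \<epsilon> \<le> log_separation_number X d \<alpha> r' \<delta>"
  unfolding log_separation_number_def
proof (rule SUP_least)
  fix A assume "A \<in> {S. finite S \<and> S \<noteq> {} \<and> S \<subseteq> Y \<and> separated_set d' \<alpha>' r \<epsilon> S}"
  then have A: "finite A" "A \<noteq> {}" "A \<subseteq> Y" "separated_set d' \<alpha>' r \<epsilon> A" by auto
  have "separated_set d \<alpha> r' \<delta> (g ` A)"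
    unfolding separated_set_def
  proof (intro ballI impI)
    fix u v assume "u \<in> g ` A" "v \<in> g ` A" "u \<noteq> v"
    then obtain S T where ST: "S \<in> A" "T \<in> A" "S \<noteq> T" "u = g S" "v = g T" by auto
    then obtain t where t: "t \<in> ball 0 r" "d' (\<alpha>' t S) (\<alpha>' t T) > \<epsilon>"
      using A(4) unfolding separated_set_def by blast
    have "S \<in> Y" "T \<in> Y" using ST(1,2) A(3) by auto
    show "\<exists>t\<in>ball 0 r'. \<delta> < d (\<alpha> t u) (\<alpha> t v)"
    proof (rule ccontr)
      assume "\<not> ?thesis"
      then have "d (\<alpha> s (g S)) (\<alpha> s (g T)) \<le> \<delta>" if "s \<in> ball 0 r'" for s
        using that ST(4,5) not_le by blast
      then have "d' (\<alpha>' t S) (\<alpha>' t T) \<le> \<epsilon>"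
        by (rule close[OF \<open>S \<in> Y\<close> \<open>T \<in> Y\<close> t(1)])
      with t(2) show False by simp
    qed
  qed
  moreover have "card (g ` A) = card A"
    using g(2) A(3) by (intro card_image) (rule inj_on_subset)
  ultimately show "ereal (ln (real (card A)))
      \<le> (SUP S\<in>{S. finite S \<and> S \<noteq> {} \<and> S \<subseteq> X \<and> separated_set d \<alpha> r' \<delta> S}. ereal (ln (real (card S))))"
    using A g(1) by (intro SUP_upper2[of "g ` A"]) auto
qed

text \<open>A growth rate larger than \<open>c\<close> for \<open>Y\<close> at scale \<open>r\<close> forces a growth rate of at least
  \<open>c / K ^ d\<close> for \<open>X\<close> at scale \<open>K * r\<close>.\<close>

lemma topological_entropy_pos_transfer:
  fixes \<alpha> :: "'v::euclidean_space \<Rightarrow> 'x \<Rightarrow> 'x" and \<alpha>' :: "'v \<Rightarrow> 'y \<Rightarrow> 'y"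
  assumes pos: "topological_entropy Y d' \<alpha>' > 0"
    and transfer: "\<And>\<epsilon>. 0 < \<epsilon> \<Longrightarrow> \<exists>\<delta>>0. \<exists>K>0. \<forall>r\<ge>1.
      log_separation_number Y d' \<alpha>' r \<epsilon> \<le> log_separation_number X d \<alpha> (K * r) \<delta>"
  shows "topological_entropy X d \<alpha> > 0"
proof -
  let ?D = "DIM('v)"
  obtain \<epsilon> where \<epsilon>: "0 < \<epsilon>" "0 < Limsup at_top (\<lambda>r::real. log_separation_number Y d' \<alpha>' r \<epsilon> / ereal (r ^ ?D))"
    using pos unfolding topological_entropy_def less_SUP_iff by auto
  obtain \<delta> K where \<delta>: "0 < \<delta>" and K: "0 < K"
    and le: "\<And>r. 1 \<le> r \<Longrightarrow> log_separation_number Y d' \<alpha>' r \<epsilon> \<le> log_separation_number X d \<alpha> (K * r) \<delta>"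
    using transfer[OF \<epsilon>(1)] by blast
  let ?F = "\<lambda>r. log_separation_number X d \<alpha> r \<delta>"
  obtain c where c: "0 < ereal c" "ereal c < Limsup at_top (\<lambda>r::real. log_separation_number Y d' \<alpha>' r \<epsilon> / ereal (r ^ ?D))"
    using ereal_dense2[OF \<epsilon>(2)] by blast
  have "ereal (c / K ^ ?D) \<le> Limsup at_top (\<lambda>r. ?F r / ereal (r ^ ?D))"
  proof (rule ccontr)
    assume "\<not> ?thesis"
    then have "\<forall>\<^sub>F r in at_top. ?F r / ereal (r ^ ?D) < ereal (c / K ^ ?D)"
      by (intro Limsup_lessD) simp
    moreover have "filterlim (\<lambda>r. K * r) at_top (at_top :: real filter)"
      using K by (intro filterlim_tendsto_pos_mult_at_top[OF tendsto_const _ filterlim_ident])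
    ultimately have "\<forall>\<^sub>F r in at_top. ?F (K * r) / ereal ((K * r) ^ ?D) < ereal (c / K ^ ?D)"
      by (rule eventually_compose_filterlim)
    then have "\<forall>\<^sub>F r in at_top. log_separation_number Y d' \<alpha>' r \<epsilon> / ereal (r ^ ?D) \<le> ereal c"
      using eventually_ge_at_top[of 1]
    proof eventually_elim
      case (elim r)
      have pos: "0 < ereal ((K * r) ^ ?D)" "0 < ereal (r ^ ?D)" using K elim(2) by simp_all
      have "log_separation_number Y d' \<alpha>' r \<epsilon> \<le> ?F (K * r)" using le elim(2) by simp
      also have "\<dots> < ereal (c / K ^ ?D) * ereal ((K * r) ^ ?D)"
        using elim(1) pos(1) by (simp only: ereal_divide_less_iff ereal_less_PInfty less_ereal.simps PInfty_neq_ereal)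
      also have "\<dots> = ereal c * ereal (r ^ ?D)" using K by (simp add: power_mult_distrib)
      finally have "log_separation_number Y d' \<alpha>' r \<epsilon> / ereal (r ^ ?D) < ereal c"
        using pos(2) by (simp add: ereal_divide_less_iff)
      then show ?case by simp
    qed
    then have "Limsup at_top (\<lambda>r::real. log_separation_number Y d' \<alpha>' r \<epsilon> / ereal (r ^ ?D)) \<le> ereal c"
      by (rule Limsup_bounded)
    with c(2) show False by simp
  qed
  moreover have "0 < ereal (c / K ^ ?D)" using c(1) K by simp
  ultimately have "0 < Limsup at_top (\<lambda>r. ?F r / ereal (r ^ ?D))" by (rule less_le_trans[rotated])
  also have "\<dots> \<le> topological_entropy X d \<alpha>"
    unfolding topological_entropy_def using \<delta> by (intro SUP_upper) simp
  finally show ?thesis .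
qed

lemma rigid_mono:
  assumes "rigid \<kappa> T" "\<kappa>' \<le> \<kappa>"
  shows "rigid \<kappa>' T"
proof -
  have "norm u < \<kappa>" if "norm u < \<kappa>'" for u :: 'a
    using that assms(2) by simp
  then show ?thesis using assms(1) unfolding rigid_def by simp
qed

lemma topspace_hull:
  "topspace (subtopology (tiling_topology \<P>) (tiling_hull \<P> T0)) = tiling_hull \<P> T0"
  unfolding tiling_hull_def topspace_subtopology
  by (rule Int_absorb1) (rule closure_of_subset_topspace)

lemma entropy_positive_homeomorphic:
  fixes \<P> :: "('a::euclidean_space, 'l) tile set set" and \<P>' :: "('a, 'm) tile set set"
  assumes \<Omega>: "aperiodic_repetitive_FLC_space \<P> \<Omega>" and \<Omega>': "aperiodic_repetitive_FLC_space \<P>' \<Omega>'"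
    and fg: "homeomorphic_maps (subtopology (tiling_topology \<P>) \<Omega>) (subtopology (tiling_topology \<P>') \<Omega>') f g"
    and pos: "topological_entropy \<Omega>' tiling_dist shift > 0"
  shows "topological_entropy \<Omega> tiling_dist shift > 0"
proof -
  from \<Omega>[unfolded aperiodic_repetitive_FLC_space_def, THEN conjunct2] obtain T0 where
    "is_tiling \<P> T0 \<and> aperiodic T0 \<and> repetitive T0 \<and> FLC T0 \<and> \<Omega> = tiling_hull \<P> T0" ..
  with \<Omega>[unfolded aperiodic_repetitive_FLC_space_def, THEN conjunct1]
  have T0: "prototile_set \<P>" "is_tiling \<P> T0" "FLC T0" "\<Omega> = tiling_hull \<P> T0"
    by simp_all
  from \<Omega>'[unfolded aperiodic_repetitive_FLC_space_def, THEN conjunct2] obtain T0' where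
    "is_tiling \<P>' T0' \<and> aperiodic T0' \<and> repetitive T0' \<and> FLC T0' \<and> \<Omega>' = tiling_hull \<P>' T0'" ..
  with \<Omega>'[unfolded aperiodic_repetitive_FLC_space_def, THEN conjunct1]
  have T0': "prototile_set \<P>'" "is_tiling \<P>' T0'" "FLC T0'" "\<Omega>' = tiling_hull \<P>' T0'"
    by simp_all
  have top: "topspace (subtopology (tiling_topology \<P>) \<Omega>) = \<Omega>"
    "topspace (subtopology (tiling_topology \<P>') \<Omega>') = \<Omega>'"
    unfolding T0(4) T0'(4) by (rule topspace_hull)+
  have cont: "continuous_map (subtopology (tiling_topology \<P>) \<Omega>) (subtopology (tiling_topology \<P>') \<Omega>') f"
    "continuous_map (subtopology (tiling_topology \<P>') \<Omega>') (subtopology (tiling_topology \<P>) \<Omega>) g"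
    and inv: "\<And>T. T \<in> \<Omega>' \<Longrightarrow> f (g T) = T"
    using fg top(2) unfolding homeomorphic_maps_def by auto
  have uc: "near_uniformly_continuous \<Omega> f" "near_uniformly_continuous \<Omega>' g"
    using hull_uniformly_continuous[OF T0(1-3) T0'(1,2)] hull_uniformly_continuous[OF T0'(1-3) T0(1,2)]
      cont T0(4) T0'(4) by simp_all
  have map: "\<And>T. T \<in> \<Omega> \<Longrightarrow> f T \<in> \<Omega>'" "\<And>T. T \<in> \<Omega>' \<Longrightarrow> g T \<in> \<Omega>"
    using continuous_map_image_subset_topspace[OF cont(1)] continuous_map_image_subset_topspace[OF cont(2)]
    unfolding top by blast+
  have shift: "\<And>x T. T \<in> \<Omega> \<Longrightarrow> shift x T \<in> \<Omega>" "\<And>x T. T \<in> \<Omega>' \<Longrightarrow> shift x T \<in> \<Omega>'"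
    using tiling_hull_shift[OF T0(1,2)] tiling_hull_shift[OF T0'(1,2)] T0(4) T0'(4) by simp_all
  obtain \<kappa>1 where \<kappa>1: "0 < \<kappa>1" "\<And>T. is_tiling \<P> T \<Longrightarrow> rigid \<kappa>1 T"
    by (rule rigid_prototiles[OF T0(1)]) blast
  obtain \<kappa>2 where \<kappa>2: "0 < \<kappa>2" "\<And>T. is_tiling \<P>' T \<Longrightarrow> rigid \<kappa>2 T"
    by (rule rigid_prototiles[OF T0'(1)]) blast
  have rig: "rigid (min \<kappa>1 \<kappa>2) T" if "T \<in> \<Omega>" for T
    using that \<kappa>1(2) mem_tiling_hull_iff[OF T0(1,2)] T0(4) rigid_mono[of \<kappa>1 T "min \<kappa>1 \<kappa>2"] by simp
  have rig': "rigid (min \<kappa>1 \<kappa>2) T" if "T \<in> \<Omega>'" for T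
    using that \<kappa>2(2) mem_tiling_hull_iff[OF T0'(1,2)] T0'(4) rigid_mono[of \<kappa>2 T "min \<kappa>1 \<kappa>2"] by simp
  have \<kappa>: "0 < min \<kappa>1 \<kappa>2" using \<kappa>1(1) \<kappa>2(1) by simp
  have "\<exists>\<delta>>0. \<exists>K>0. \<forall>r\<ge>1. log_separation_number \<Omega>' tiling_dist shift r \<epsilon>
      \<le> log_separation_number \<Omega> tiling_dist shift (K * r) \<delta>" if "0 < \<epsilon>" for \<epsilon>
  proof -
    have "\<exists>\<delta>>0. \<exists>K>0. \<forall>r\<ge>1. \<forall>S\<in>\<Omega>'. \<forall>T\<in>\<Omega>'.
        (\<forall>s\<in>ball 0 (K * r). tiling_dist (shift s (g S)) (shift s (g T)) \<le> \<delta>) \<longrightarrow>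
        (\<forall>t\<in>ball 0 r. tiling_dist (shift t S) (shift t T) \<le> \<epsilon>)"
      by (rule separation_transfer[OF \<kappa> rig shift(1) rig' shift(2) uc(1) map(1) uc(2) map(2) inv \<open>0 < \<epsilon>\<close>])
    then obtain \<delta> K where \<delta>: "0 < \<delta>" and K: "0 < K"
      and close: "\<forall>r\<ge>1. \<forall>S\<in>\<Omega>'. \<forall>T\<in>\<Omega>'.
        (\<forall>s\<in>ball 0 (K * r). tiling_dist (shift s (g S)) (shift s (g T)) \<le> \<delta>) \<longrightarrow>
        (\<forall>t\<in>ball 0 r. tiling_dist (shift t S) (shift t T) \<le> \<epsilon>)"
      by (elim exE conjE)
    have g: "g ` \<Omega>' \<subseteq> \<Omega>" "inj_on g \<Omega>'"
      using map(2) inv by (auto intro: inj_on_inverseI)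
    have "log_separation_number \<Omega>' tiling_dist shift r \<epsilon>
        \<le> log_separation_number \<Omega> tiling_dist shift (K * r) \<delta>" if "1 \<le> r" for r
    proof (rule log_separation_number_transfer[OF g])
      fix S T and t :: 'a
      assume "S \<in> \<Omega>'" "T \<in> \<Omega>'" "t \<in> ball 0 r"
        and "\<And>s. s \<in> ball 0 (K * r) \<Longrightarrow> tiling_dist (shift s (g S)) (shift s (g T)) \<le> \<delta>"
      with that close show "tiling_dist (shift t S) (shift t T) \<le> \<epsilon>" by simp
    qed
    then have "\<forall>r\<ge>1. log_separation_number \<Omega>' tiling_dist shift r \<epsilon>
        \<le> log_separation_number \<Omega> tiling_dist shift (K * r) \<delta>" by simp
    with K have K': "\<exists>K>0. \<forall>r\<ge>1. log_separation_number \<Omega>' tiling_dist shift r \<epsilon>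
        \<le> log_separation_number \<Omega> tiling_dist shift (K * r) \<delta>" by (intro exI[of _ K] conjI)
    show ?thesis by (rule exI[of _ \<delta>], rule conjI, rule \<delta>, rule K')
  qed
  then show ?thesis by (rule topological_entropy_pos_transfer[OF pos])
qed

theorem mainTheorem6:
  fixes \<P> :: "('a::euclidean_space, 'l) tile set set"
    and \<P>' :: "('a, 'm) tile set set"
    and \<Omega> :: "('a, 'l) tiling set"
    and \<Omega>' :: "('a, 'm) tiling set"
  assumes "aperiodic_repetitive_FLC_space \<P> \<Omega>"
    and "aperiodic_repetitive_FLC_space \<P>' \<Omega>'"
    and "subtopology (tiling_topology \<P>) \<Omega> homeomorphic_space subtopology (tiling_topology \<P>') \<Omega>'"
  shows "topological_entropy \<Omega> tiling_dist shift > 0 \<longleftrightarrow> topological_entropy \<Omega>' tiling_dist shift > 0"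
proof -
  obtain f g where fg: "homeomorphic_maps (subtopology (tiling_topology \<P>) \<Omega>)
      (subtopology (tiling_topology \<P>') \<Omega>') f g"
    using assms(3) unfolding homeomorphic_space_def by blast
  then have gf: "homeomorphic_maps (subtopology (tiling_topology \<P>') \<Omega>')
      (subtopology (tiling_topology \<P>) \<Omega>) g f"
    by (rule homeomorphic_maps_sym[THEN iffD1])
  show ?thesis
    using entropy_positive_homeomorphic[OF assms(1,2) fg]
      entropy_positive_homeomorphic[OF assms(2,1) gf] by blast
qed

end
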